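(* Let $\Psi$ be a nonassociative (commutative) arithmetic circuit of size $s$ computing an $n$-variate polynomial $f\in\mathbb{F}_{\bar{A},C}[x_1,\ldots,x_n]$ of degree $\le d$. Given $\Psi$ as input, one can decide whether $f\equiv 0$ deterministically in time $\mathrm{poly}(s,n,d)$.
   Context: $\mathbb{F}_{\bar{A},C}[X]$ is the commutative, nonassociative polynomial algebra over a field $\mathbb{F}$: the $\mathbb{F}$-vector space with basis the monomial $1$ together with rooted full binary trees whose leaves are labeled by variables from $X=\{x_1,\ldots,x_n\}$, identified up to swapping children at internal nodes; the product of monomials $m_1,m_2$ is the tree whose root has subtrees $m_1,m_2$, extended bilinearly. Degree = number of leaves. An arithmetic circuit over $\mathbb{F}_{\bar{A},C}[X]$ is a directed acyclic graph whose leaves are labeled by variables or field elements and whose internal gates are sum gates or product gates of fan-in $2$; each gate computes an element of $\mathbb{F}_{\bar{A},C}[X]$ in the natural way (product gates use the commutative nonassociative product), and the circuit computes the polynomial at a designated output gate. Its size is the number of gates. *)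

theory Defs
  imports Main "HOL-Library.Poly_Mapping" "HOL-Library.Uprod"
begin

section \<open>Commutative nonassociative polynomials\<close>

text \<open>
  Rooted full binary trees with leaves labelled by variables. The children of an internal node
  form an unordered pair, so trees that differ only by swapping children are equal. The
  variables \<open>x\<^sub>1, \<dots>, x\<^sub>n\<close> are represented by the numbers \<open>0, \<dots>, n - 1\<close>.
\<close>

datatype ctree = Leaf nat | Node "ctree uprod"

datatype mono = MOne | MTree ctree

lift_definition add_commute :: "(nat, nat) commute" is "(+)"
  by auto

primrec leaves :: "ctree \<Rightarrow> nat" where
  "leaves (Leaf x) = 1"
| "leaves (Node p) = case_uprod add_commute (map_uprod leaves p)"

lemma leaves_Node_Upair [simp]: "leaves (Node (Upair t u)) = leaves t + leaves u"
  by (simp add: add_commute.rep_eq)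

primrec mono_degree :: "mono \<Rightarrow> nat" where
  "mono_degree MOne = 0"
| "mono_degree (MTree t) = leaves t"

fun mono_mult :: "mono \<Rightarrow> mono \<Rightarrow> mono" where
  "mono_mult MOne m = m"
| "mono_mult m MOne = m"
| "mono_mult (MTree t) (MTree u) = MTree (Node (Upair t u))"

lemma mono_mult_commute: "mono_mult l m = mono_mult m l"
  by (cases l; cases m) auto

type_synonym 'a napoly = "mono \<Rightarrow>\<^sub>0 'a"

text \<open>
  The library product on finitely supported functions needs a monoid structure on the monomials,
  which the nonassociative monomials do not have.
\<close>

definition np_mult :: "'a::field napoly \<Rightarrow> 'a napoly \<Rightarrow> 'a napoly" where
  "np_mult f g =
    (\<Sum>l\<in>Poly_Mapping.keys f. \<Sum>m\<in>Poly_Mapping.keys g.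
       Poly_Mapping.single (mono_mult l m) (Poly_Mapping.lookup f l * Poly_Mapping.lookup g m))"

definition np_const :: "'a::field \<Rightarrow> 'a napoly" where
  "np_const c = Poly_Mapping.single MOne c"

definition np_var :: "nat \<Rightarrow> 'a::field napoly" where
  "np_var x = Poly_Mapping.single (MTree (Leaf x)) 1"

text \<open>The zero polynomial has degree \<open>0\<close>.\<close>

definition np_degree :: "'a::field napoly \<Rightarrow> nat" where
  "np_degree f = Max (insert 0 (mono_degree ` Poly_Mapping.keys f))"

lemma np_degree_le_iff:
  "np_degree f \<le> d \<longleftrightarrow> (\<forall>m\<in>Poly_Mapping.keys f. mono_degree m \<le> d)"
  by (auto simp: np_degree_def)

lemma np_mult_commute: "np_mult f g = np_mult g f"
  unfolding np_mult_def
  by (subst sum.swap) (simp add: mono_mult_commute mult.commute)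

lemma np_mult_superset:
  assumes "finite A" "finite B" "Poly_Mapping.keys f \<subseteq> A" "Poly_Mapping.keys g \<subseteq> B"
  shows "np_mult f g =
    (\<Sum>l\<in>A. \<Sum>m\<in>B.
       Poly_Mapping.single (mono_mult l m) (Poly_Mapping.lookup f l * Poly_Mapping.lookup g m))"
proof -
  have "(\<Sum>m\<in>Poly_Mapping.keys g.
          Poly_Mapping.single (mono_mult l m) (Poly_Mapping.lookup f l * Poly_Mapping.lookup g m)) =
        (\<Sum>m\<in>B.
          Poly_Mapping.single (mono_mult l m) (Poly_Mapping.lookup f l * Poly_Mapping.lookup g m))"
    for l
    by (rule sum.mono_neutral_left) (use assms in \<open>auto simp: in_keys_iff\<close>)
  then show ?thesis
    unfolding np_mult_def
    by (simp, intro sum.mono_neutral_left) (use assms in \<open>auto simp: in_keys_iff\<close>)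
qed

lemma np_mult_add_left: "np_mult (f + g) h = np_mult f h + np_mult g h"
proof -
  let ?A = "Poly_Mapping.keys f \<union> Poly_Mapping.keys g"
  have "Poly_Mapping.keys (f + g) \<subseteq> ?A"
    by (rule Poly_Mapping.keys_add)
  then show ?thesis
    by (simp add: np_mult_superset[of ?A "Poly_Mapping.keys h"] lookup_add distrib_right
        single_add sum.distrib)
qed

lemma np_mult_single:
  "np_mult (Poly_Mapping.single l a) (Poly_Mapping.single m b) =
    Poly_Mapping.single (mono_mult l m) (a * b)"
  by (simp add: np_mult_superset[of "{l}" "{m}"] split: if_splits)

section \<open>Arithmetic circuits\<close>

text \<open>
  The nodes of a circuit are the positions in its gate list, leaves included. The order of the
  list need not be topological. A gate may use the same node for both of its inputs.
\<close>

datatype 'a gate = Var nat | Const 'a | Sum nat nat | Prod nat nat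

record 'a circuit =
  gates :: "'a gate list"
  out :: nat

definition circuit_size :: "'a circuit \<Rightarrow> nat" where
  "circuit_size \<Psi> = length (gates \<Psi>)"

primrec children :: "'a gate \<Rightarrow> nat set" where
  "children (Var x) = {}"
| "children (Const c) = {}"
| "children (Sum j k) = {j, k}"
| "children (Prod j k) = {j, k}"

definition wires :: "'a circuit \<Rightarrow> (nat \<times> nat) set" where
  "wires \<Psi> = {(j, i). i < circuit_size \<Psi> \<and> j \<in> children (gates \<Psi> ! i)}"

definition circuit_over :: "nat \<Rightarrow> 'a circuit \<Rightarrow> bool" where
  "circuit_over n \<Psi> \<longleftrightarrow>
    out \<Psi> < circuit_size \<Psi> \<and>
    (\<forall>i<circuit_size \<Psi>. children (gates \<Psi> ! i) \<subseteq> {..<circuit_size \<Psi>}) \<and>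
    (\<forall>x. Var x \<in> set (gates \<Psi>) \<longrightarrow> x < n) \<and>
    acyclic (wires \<Psi>)"

inductive gate_computes :: "'a::field circuit \<Rightarrow> nat \<Rightarrow> 'a napoly \<Rightarrow> bool" for \<Psi> where
  var: "i < circuit_size \<Psi> \<Longrightarrow> gates \<Psi> ! i = Var x \<Longrightarrow> gate_computes \<Psi> i (np_var x)"
| const: "i < circuit_size \<Psi> \<Longrightarrow> gates \<Psi> ! i = Const c \<Longrightarrow> gate_computes \<Psi> i (np_const c)"
| sum: "i < circuit_size \<Psi> \<Longrightarrow> gates \<Psi> ! i = Sum j k \<Longrightarrow>
    gate_computes \<Psi> j f \<Longrightarrow> gate_computes \<Psi> k g \<Longrightarrow> gate_computes \<Psi> i (f + g)"
| prod: "i < circuit_size \<Psi> \<Longrightarrow> gates \<Psi> ! i = Prod j k \<Longrightarrow>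
    gate_computes \<Psi> j f \<Longrightarrow> gate_computes \<Psi> k g \<Longrightarrow> gate_computes \<Psi> i (np_mult f g)"

definition circuit_computes :: "'a::field circuit \<Rightarrow> 'a napoly \<Rightarrow> bool" where
  "circuit_computes \<Psi> f \<longleftrightarrow> gate_computes \<Psi> (out \<Psi>) f"

lemma gate_computes_unique:
  "gate_computes \<Psi> i f \<Longrightarrow> gate_computes \<Psi> i g \<Longrightarrow> f = g"
proof (induction arbitrary: g rule: gate_computes.induct)
  case (var i x)
  from var(3,1,2) show ?case by cases auto
next
  case (const i c)
  from const(3,1,2) show ?case by cases auto
next
  case (sum i j k f g)
  from sum.prems sum.hyps(1,2) sum.IH show ?case by cases auto
next
  case (prod i j k f g)
  from prod.prems prod.hyps(1,2) prod.IH show ?case by cases auto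
qed

lemma circuit_computes_ex1:
  assumes "circuit_over n \<Psi>"
  shows "\<exists>!f. circuit_computes \<Psi> f"
proof -
  let ?N = "circuit_size \<Psi>"
  have "wires \<Psi> \<subseteq> {..<?N} \<times> {..<?N}"
    using assms by (auto simp: circuit_over_def wires_def)
  then have "finite (wires \<Psi>)"
    by (rule finite_subset) auto
  then have wf: "wf (wires \<Psi>)"
    using assms by (intro finite_acyclic_wf) (auto simp: circuit_over_def)
  have "i < ?N \<longrightarrow> (\<exists>f. gate_computes \<Psi> i f)" for i
    using wf
  proof (induction i)
    case (less i)
    show ?case
    proof
      assume i: "i < ?N"
      then have ch: "\<exists>f. gate_computes \<Psi> j f" if "j \<in> children (gates \<Psi> ! i)" for j
        using less that assms by (auto simp: circuit_over_def wires_def)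
      show "\<exists>f. gate_computes \<Psi> i f"
      proof (cases "gates \<Psi> ! i")
        case (Var x)
        from gate_computes.var[OF i Var] show ?thesis ..
      next
        case (Const c)
        from gate_computes.const[OF i Const] show ?thesis ..
      next
        case (Sum j k)
        then obtain f g where "gate_computes \<Psi> j f" "gate_computes \<Psi> k g"
          using ch[of j] ch[of k] by auto
        from gate_computes.sum[OF i Sum this] show ?thesis ..
      next
        case (Prod j k)
        then obtain f g where "gate_computes \<Psi> j f" "gate_computes \<Psi> k g"
          using ch[of j] ch[of k] by auto
        from gate_computes.prod[OF i Prod this] show ?thesis ..
      qed
    qed
  qed
  then show ?thesis
    using assms gate_computes_unique by (auto simp: circuit_computes_def circuit_over_def)
qed

section \<open>Deterministic algorithms over a field\<close>

text \<open>
  Algorithms are programs of an algebraic random access machine. A store consists of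
  natural-number variables and arrays and of field variables and arrays. A program mentions
  finitely many of them by name, and is itself independent of the field: the only field constants
  in it are 0 and 1.

  Every arithmetic operation, comparison, zero test, memory access and control step is charged
  one unit. The only arithmetic on natural numbers is addition and truncated subtraction:
  a unit-cost multiplication would create numbers of exponential bit length in polynomially
  many steps. Division by zero in the field yields zero, as in the library.
\<close>

record 'a store =
  nvar :: "string \<Rightarrow> nat"
  narr :: "string \<Rightarrow> nat \<Rightarrow> nat"
  fvar :: "string \<Rightarrow> 'a"
  farr :: "string \<Rightarrow> nat \<Rightarrow> 'a"

datatype nexp = NLit nat | NVar string | NArr string nexp | NAdd nexp nexp | NSub nexp nexp

datatype fexp = FZero | FOne | FVar string | FArr string nexp
  | FAdd fexp fexp | FSub fexp fexp | FMul fexp fexp | FDiv fexp fexp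

datatype bexp = NLess nexp nexp | NEq nexp nexp | FIsZero fexp | BNot bexp | BAnd bexp bexp

datatype com =
    Skip
  | NAssign string nexp
  | NStore string nexp nexp
  | FAssign string fexp
  | FStore string nexp fexp
  | Seq com com
  | Cond bexp com com
  | Loop bexp com

primrec nval :: "nexp \<Rightarrow> 'a::field store \<Rightarrow> nat" where
  "nval (NLit k) s = k"
| "nval (NVar x) s = nvar s x"
| "nval (NArr a e) s = narr s a (nval e s)"
| "nval (NAdd d e) s = nval d s + nval e s"
| "nval (NSub d e) s = nval d s - nval e s"

primrec fval :: "fexp \<Rightarrow> 'a::field store \<Rightarrow> 'a" where
  "fval FZero s = 0"
| "fval FOne s = 1"
| "fval (FVar x) s = fvar s x"
| "fval (FArr a e) s = farr s a (nval e s)"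
| "fval (FAdd d e) s = fval d s + fval e s"
| "fval (FSub d e) s = fval d s - fval e s"
| "fval (FMul d e) s = fval d s * fval e s"
| "fval (FDiv d e) s = fval d s / fval e s"

primrec bval :: "bexp \<Rightarrow> 'a::field store \<Rightarrow> bool" where
  "bval (NLess d e) s \<longleftrightarrow> nval d s < nval e s"
| "bval (NEq d e) s \<longleftrightarrow> nval d s = nval e s"
| "bval (FIsZero e) s \<longleftrightarrow> fval e s = 0"
| "bval (BNot b) s \<longleftrightarrow> \<not> bval b s"
| "bval (BAnd b c) s \<longleftrightarrow> bval b s \<and> bval c s"

primrec ncost :: "nexp \<Rightarrow> nat" where
  "ncost (NLit k) = 1"
| "ncost (NVar x) = 1"
| "ncost (NArr a e) = 1 + ncost e"
| "ncost (NAdd d e) = 1 + ncost d + ncost e"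
| "ncost (NSub d e) = 1 + ncost d + ncost e"

primrec fcost :: "fexp \<Rightarrow> nat" where
  "fcost FZero = 1"
| "fcost FOne = 1"
| "fcost (FVar x) = 1"
| "fcost (FArr a e) = 1 + ncost e"
| "fcost (FAdd d e) = 1 + fcost d + fcost e"
| "fcost (FSub d e) = 1 + fcost d + fcost e"
| "fcost (FMul d e) = 1 + fcost d + fcost e"
| "fcost (FDiv d e) = 1 + fcost d + fcost e"

primrec bcost :: "bexp \<Rightarrow> nat" where
  "bcost (NLess d e) = 1 + ncost d + ncost e"
| "bcost (NEq d e) = 1 + ncost d + ncost e"
| "bcost (FIsZero e) = 1 + fcost e"
| "bcost (BNot b) = 1 + bcost b"
| "bcost (BAnd b c) = 1 + bcost b + bcost c"

text \<open>\<open>exec c s t s'\<close>: started in \<open>s\<close>, the program \<open>c\<close> halts in \<open>s'\<close> after \<open>t\<close> steps.\<close>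

inductive exec :: "com \<Rightarrow> 'a::field store \<Rightarrow> nat \<Rightarrow> 'a store \<Rightarrow> bool" where
  Skip: "exec Skip s 1 s"
| NAssign: "exec (NAssign x e) s (1 + ncost e) (s\<lparr>nvar := (nvar s)(x := nval e s)\<rparr>)"
| NStore: "exec (NStore a d e) s (1 + ncost d + ncost e)
    (s\<lparr>narr := (narr s)(a := (narr s a)(nval d s := nval e s))\<rparr>)"
| FAssign: "exec (FAssign x e) s (1 + fcost e) (s\<lparr>fvar := (fvar s)(x := fval e s)\<rparr>)"
| FStore: "exec (FStore a d e) s (1 + ncost d + fcost e)
    (s\<lparr>farr := (farr s)(a := (farr s a)(nval d s := fval e s))\<rparr>)"
| Seq: "exec c1 s1 t1 s2 \<Longrightarrow> exec c2 s2 t2 s3 \<Longrightarrow> exec (Seq c1 c2) s1 (t1 + t2) s3"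
| CondTrue: "bval b s \<Longrightarrow> exec c1 s t s' \<Longrightarrow> exec (Cond b c1 c2) s (1 + bcost b + t) s'"
| CondFalse: "\<not> bval b s \<Longrightarrow> exec c2 s t s' \<Longrightarrow> exec (Cond b c1 c2) s (1 + bcost b + t) s'"
| LoopFalse: "\<not> bval b s \<Longrightarrow> exec (Loop b c) s (1 + bcost b) s"
| LoopTrue: "bval b s1 \<Longrightarrow> exec c s1 t1 s2 \<Longrightarrow> exec (Loop b c) s2 t2 s3 \<Longrightarrow>
    exec (Loop b c) s1 (1 + bcost b + t1 + t2) s3"

lemma exec_deterministic:
  "exec c s t s' \<Longrightarrow> exec c s u s'' \<Longrightarrow> t = u \<and> s' = s''"
proof (induction arbitrary: u s'' rule: exec.induct)
  case Skip
  then show ?case by cases auto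
next
  case NAssign
  then show ?case by cases auto
next
  case NStore
  then show ?case by cases auto
next
  case FAssign
  then show ?case by cases auto
next
  case FStore
  then show ?case by cases auto
next
  case (Seq c1 s1 t1 s2 c2 t2 s3)
  from Seq.prems show ?case
  proof cases
    case (Seq t1' s2' t2')
    from Seq.IH(1)[OF Seq(2)] have eq: "t1 = t1'" "s2 = s2'" by auto
    from Seq.IH(2)[of t2' s''] Seq(3) eq Seq(1) show ?thesis by auto
  qed
next
  case (CondTrue b s c1 t s' c2)
  from CondTrue.prems show ?case
  proof cases
    case (CondTrue t')
    with CondTrue.IH[OF CondTrue(3)] show ?thesis by simp
  next
    case CondFalse
    with CondTrue.hyps show ?thesis by simp
  qed
next
  case (CondFalse b s c2 t s' c1)
  from CondFalse.prems show ?case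
  proof cases
    case CondTrue
    with CondFalse.hyps show ?thesis by simp
  next
    case (CondFalse t')
    with CondFalse.IH[OF CondFalse(3)] show ?thesis by simp
  qed
next
  case LoopFalse
  from LoopFalse.prems LoopFalse.hyps show ?case by cases simp_all
next
  case (LoopTrue b s1 c t1 s2 t2 s3)
  from LoopTrue.prems show ?case
  proof cases
    case LoopFalse
    with LoopTrue.hyps show ?thesis by simp
  next
    case (LoopTrue t1' s2' t2')
    from LoopTrue.IH(1)[OF LoopTrue(3)] have eq: "t1 = t1'" "s2 = s2'" by auto
    from LoopTrue.IH(2)[of t2' s''] LoopTrue(4) eq LoopTrue(1) show ?thesis by auto
  qed
qed

section \<open>Circuits as inputs\<close>

primrec gate_kind :: "'a gate \<Rightarrow> nat" where
  "gate_kind (Var x) = 0"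
| "gate_kind (Const c) = 1"
| "gate_kind (Sum j k) = 2"
| "gate_kind (Prod j k) = 3"

primrec gate_fst :: "'a gate \<Rightarrow> nat" where
  "gate_fst (Var x) = x"
| "gate_fst (Const c) = 0"
| "gate_fst (Sum j k) = j"
| "gate_fst (Prod j k) = j"

primrec gate_snd :: "'a gate \<Rightarrow> nat" where
  "gate_snd (Var x) = 0"
| "gate_snd (Const c) = 0"
| "gate_snd (Sum j k) = k"
| "gate_snd (Prod j k) = k"

primrec gate_const :: "'a::field gate \<Rightarrow> 'a" where
  "gate_const (Var x) = 0"
| "gate_const (Const c) = c"
| "gate_const (Sum j k) = 0"
| "gate_const (Prod j k) = 0"

text \<open>Every variable and array cell that does not hold a part of the input is initially zero.\<close>

definition per_gate :: "('a gate \<Rightarrow> 'b::zero) \<Rightarrow> 'a circuit \<Rightarrow> nat \<Rightarrow> 'b" where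
  "per_gate h \<Psi> i = (if i < circuit_size \<Psi> then h (gates \<Psi> ! i) else 0)"

definition input_store :: "nat \<Rightarrow> nat \<Rightarrow> 'a::field circuit \<Rightarrow> 'a store" where
  "input_store n d \<Psi> =
    \<lparr>nvar = (\<lambda>_. 0)(''n'' := n, ''d'' := d, ''size'' := circuit_size \<Psi>, ''out'' := out \<Psi>),
     narr = (\<lambda>_ _. 0)(''kind'' := per_gate gate_kind \<Psi>,
                      ''fst'' := per_gate gate_fst \<Psi>,
                      ''snd'' := per_gate gate_snd \<Psi>),
     fvar = (\<lambda>_. 0),
     farr = (\<lambda>_ _. 0)(''const'' := per_gate gate_const \<Psi>)\<rparr>"

end

(*
  For a tree t let v_t be the vector of its coefficients at all gates of the circuit. The entries
  of v_t satisfy a linear system along the wires whose matrix involves only the constant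
  coefficients of the gates. The inhomogeneous part for the tree with subtrees t and u is bilinear
  in v_t and v_u if t and u differ, and quadratic in v_t if they are equal; the bilinear map is the
  polarization of the quadratic one. Hence the span of all v_t is the least subspace that contains
  the vectors of the single-leaf trees and is closed under both maps. Its dimension is at most the
  size s of the circuit, so starting from the leaves and applying the maps to all pairs of basis
  vectors, with Gaussian elimination, reaches it within s + 1 rounds. The polynomial vanishes
  iff the constant coefficient and the output entries of all basis vectors do.
*)
theory Submission
  imports Defs Complex_Main "HOL-Library.Function_Algebras"
begin

section \<open>Coefficients of products\<close>

text \<open>A polynomial of degree d can contain a number of trees that is exponential in the size
  of the circuit, so coefficients cannot be listed. The trees can be handled through vectors because
  a nonassociative monomial has, apart from factors \<open>MOne\<close>, only one factorization up
  to order: the coefficients of a tree at all gates are determined by those of its two subtrees.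
  Factors \<open>MOne\<close> couple the same tree at different gates, and this yields the linear
  part of the system. A tree with equal subtrees arises from one ordered pair of factors, not from
  two. In characteristic 2 the polar form vanishes on the diagonal, so the quadratic map cannot be
  recovered from it and both maps are needed. The number of pivots stands in for the dimension: a
  round that gains no pivot has tested all pairs against one unchanged matrix, which then spans
  everything. The exponent 5 comes from the rounds, the two indices of a pair, and the quadratic
  cost of solving one system or inserting one vector.\<close>

lemma lookup_np_mult:
  assumes "finite D" "\<And>l l'. mono_mult l l' = m \<longleftrightarrow> (l, l') \<in> D"
  shows "Poly_Mapping.lookup (np_mult f g) m =
    (\<Sum>(l, l')\<in>D. Poly_Mapping.lookup f l * Poly_Mapping.lookup g l')"
proof -
  \<comment> \<open>Enlarging the key sets by the components of \<open>D\<close> makes the rectangle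
    contain \<open>D\<close>; the additional pairs have a zero coefficient.\<close>
  let ?A = "Poly_Mapping.keys f \<union> fst ` D" and ?B = "Poly_Mapping.keys g \<union> snd ` D"
  have fin: "finite ?A" "finite ?B"
    using assms(1) by auto
  have "Poly_Mapping.lookup (np_mult f g) m =
    (\<Sum>l\<in>?A. \<Sum>l'\<in>?B. if (l, l') \<in> D
       then Poly_Mapping.lookup f l * Poly_Mapping.lookup g l' else 0)"
    using fin by (subst np_mult_superset[of ?A ?B])
      (auto simp: lookup_sum lookup_single when_def assms(2) intro!: sum.cong)
  also have "\<dots> = (\<Sum>z\<in>?A \<times> ?B. if z \<in> D
       then Poly_Mapping.lookup f (fst z) * Poly_Mapping.lookup g (snd z) else 0)"
    by (simp add: sum.cartesian_product case_prod_unfold)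
  also have "\<dots> = (\<Sum>z\<in>D. Poly_Mapping.lookup f (fst z) * Poly_Mapping.lookup g (snd z))"
    using fin by (intro sum.mono_neutral_cong_right) force+
  finally show ?thesis
    by (simp add: case_prod_unfold)
qed

lemma lookup_np_mult_MOne:
  "Poly_Mapping.lookup (np_mult f g) MOne =
    Poly_Mapping.lookup f MOne * Poly_Mapping.lookup g MOne"
proof -
  have "mono_mult l l' = MOne \<longleftrightarrow> (l, l') \<in> {(MOne, MOne)}" for l l'
    by (cases l; cases l') auto
  from lookup_np_mult[OF _ this] show ?thesis by simp
qed

lemma lookup_np_mult_Leaf:
  "Poly_Mapping.lookup (np_mult f g) (MTree (Leaf x)) =
    Poly_Mapping.lookup f MOne * Poly_Mapping.lookup g (MTree (Leaf x)) +
    Poly_Mapping.lookup g MOne * Poly_Mapping.lookup f (MTree (Leaf x))"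
proof -
  have "mono_mult l l' = MTree (Leaf x) \<longleftrightarrow>
      (l, l') \<in> {(MOne, MTree (Leaf x)), (MTree (Leaf x), MOne)}" for l l'
    by (cases l; cases l') auto
  from lookup_np_mult[OF _ this] show ?thesis by (simp add: mult.commute)
qed

text \<open>The tree splits with \<open>MOne\<close> on either side, or into its two subtrees in
  either order. For \<open>t = u\<close> the last two orders coincide and count once.\<close>

lemma lookup_np_mult_Node:
  "Poly_Mapping.lookup (np_mult f g) (MTree (Node (Upair t u))) =
    Poly_Mapping.lookup f MOne * Poly_Mapping.lookup g (MTree (Node (Upair t u))) +
    Poly_Mapping.lookup g MOne * Poly_Mapping.lookup f (MTree (Node (Upair t u))) +
    (Poly_Mapping.lookup f (MTree t) * Poly_Mapping.lookup g (MTree u) +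
     (if t = u then 0 else Poly_Mapping.lookup f (MTree u) * Poly_Mapping.lookup g (MTree t)))"
proof -
  have "mono_mult l l' = MTree (Node (Upair t u)) \<longleftrightarrow>
      (l, l') \<in> {(MOne, MTree (Node (Upair t u))), (MTree (Node (Upair t u)), MOne),
        (MTree t, MTree u), (MTree u, MTree t)}" for l l'
    by (cases l; cases l') auto
  from lookup_np_mult[OF _ this] show ?thesis
    by (cases "t = u") (simp_all add: algebra_simps)
qed

section \<open>Coefficient vectors of a circuit\<close>

locale valid_circuit =
  fixes n :: nat and \<Psi> :: "'a::field circuit"
  assumes over: "circuit_over n \<Psi>"
begin

abbreviation S where "S \<equiv> circuit_size \<Psi>"

lemma out_less: "out \<Psi> < S"
  using over by (simp add: circuit_over_def)

lemma children_less: "i < S \<Longrightarrow> j \<in> children (gates \<Psi> ! i) \<Longrightarrow> j < S"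
  using over by (auto simp: circuit_over_def)

lemma Sum_less: "i < S \<Longrightarrow> gates \<Psi> ! i = Sum j k \<Longrightarrow> j < S \<and> k < S"
  and Prod_less: "i < S \<Longrightarrow> gates \<Psi> ! i = Prod j k \<Longrightarrow> j < S \<and> k < S"
  using children_less[of i] by auto

lemma Var_less: "i < S \<Longrightarrow> gates \<Psi> ! i = Var x \<Longrightarrow> x < n"
  using over unfolding circuit_over_def circuit_size_def by (metis nth_mem)

text \<open>Counts the gates on which \<open>i\<close> depends. A number, rather than the
  well-founded order alone, bounds how many passes over the gate list make a value final.\<close>

definition rank :: "nat \<Rightarrow> nat" where
  "rank i = card {j. (j, i) \<in> (wires \<Psi>)\<^sup>+}"

lemma ancestors: "{j. (j, i) \<in> (wires \<Psi>)\<^sup>+} \<subseteq> {..<S}" "i \<notin> {j. (j, i) \<in> (wires \<Psi>)\<^sup>+}"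
proof -
  show "i \<notin> {j. (j, i) \<in> (wires \<Psi>)\<^sup>+}"
    using over by (simp add: circuit_over_def acyclic_def)
  have "(j, i) \<in> (wires \<Psi>)\<^sup>+ \<Longrightarrow> j < S" for j
    by (induction rule: trancl_induct) (auto simp: wires_def dest: children_less)
  then show "{j. (j, i) \<in> (wires \<Psi>)\<^sup>+} \<subseteq> {..<S}" by auto
qed

text \<open>The inclusion is strict because \<open>j\<close> lies below \<open>i\<close> but, by
  acyclicity, not below itself.\<close>

lemma rank_child: "i < S \<Longrightarrow> j \<in> children (gates \<Psi> ! i) \<Longrightarrow> rank j < rank i"
proof -
  assume "i < S" "j \<in> children (gates \<Psi> ! i)"
  then have w: "(j, i) \<in> wires \<Psi>" by (simp add: wires_def)
  have "finite {j. (j, i) \<in> (wires \<Psi>)\<^sup>+}"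
    using ancestors(1) finite_subset by blast
  moreover have "{k. (k, j) \<in> (wires \<Psi>)\<^sup>+} \<subset> {j. (j, i) \<in> (wires \<Psi>)\<^sup>+}"
    using ancestors(2)[of j] w by (auto intro: trancl_into_trancl)
  ultimately show ?thesis
    unfolding rank_def by (rule psubset_card_mono)
qed

lemma rank_less: "i < S \<Longrightarrow> rank i < S"
proof -
  assume "i < S"
  then have "{j. (j, i) \<in> (wires \<Psi>)\<^sup>+} \<subset> {..<S}"
    using ancestors[of i] by auto
  then have "rank i < card {..<S}"
    unfolding rank_def by (intro psubset_card_mono) auto
  then show ?thesis by simp
qed

lemma gate_induct [consumes 1, case_names gate]:
  assumes "i < S"
    and "\<And>i. i < S \<Longrightarrow> (\<And>j. j \<in> children (gates \<Psi> ! i) \<Longrightarrow> P j) \<Longrightarrow> P i"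
  shows "P i"
  using assms(1)
proof (induction "rank i" arbitrary: i rule: less_induct)
  case less
  then show ?case
    using assms(2) children_less rank_child by blast
qed

section \<open>The polynomials computed at the gates\<close>

definition gate_poly :: "nat \<Rightarrow> 'a napoly" where
  "gate_poly i = (THE f. gate_computes \<Psi> i f)"

lemma gate_poly_eqI: "gate_computes \<Psi> i f \<Longrightarrow> gate_poly i = f"
  unfolding gate_poly_def using gate_computes_unique by blast

lemma gate_computes_gate_poly: "i < S \<Longrightarrow> gate_computes \<Psi> i (gate_poly i)"
proof (induction rule: gate_induct)
  case (gate i)
  have "\<exists>f. gate_computes \<Psi> i f"
  proof (cases "gates \<Psi> ! i")
    case (Var x)
    then show ?thesis using gate(1) gate_computes.var by blast
  next
    case (Const c)
    then show ?thesis using gate(1) gate_computes.const by blast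
  next
    case (Sum j k)
    then show ?thesis
      using gate_computes.sum[OF gate(1) Sum] gate(2)[of j] gate(2)[of k] by fastforce
  next
    case (Prod j k)
    then show ?thesis
      using gate_computes.prod[OF gate(1) Prod] gate(2)[of j] gate(2)[of k] by fastforce
  qed
  then show ?case using gate_poly_eqI by auto
qed

text \<open>The cut-off at \<open>S\<close> turns the vectors into functions with support below
  \<open>S\<close>, which can be compared as functions and fit \<open>echelon S\<close>.\<close>

definition coef :: "mono \<Rightarrow> nat \<Rightarrow> 'a" where
  "coef m i = (if i < S then Poly_Mapping.lookup (gate_poly i) m else 0)"

lemma coef_Var:
  "i < S \<Longrightarrow> gates \<Psi> ! i = Var x \<Longrightarrow> coef m i = (if m = MTree (Leaf x) then 1 else 0)"
  using gate_poly_eqI[OF gate_computes.var]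
  by (auto simp: coef_def np_var_def lookup_single when_def)

lemma coef_Const:
  "i < S \<Longrightarrow> gates \<Psi> ! i = Const c \<Longrightarrow> coef m i = (if m = MOne then c else 0)"
  using gate_poly_eqI[OF gate_computes.const]
  by (auto simp: coef_def np_const_def lookup_single when_def)

lemma coef_Sum:
  assumes "i < S" "gates \<Psi> ! i = Sum j k"
  shows "coef m i = coef m j + coef m k"
proof -
  have "gate_poly i = gate_poly j + gate_poly k"
    using Sum_less[OF assms] gate_computes_gate_poly
    by (intro gate_poly_eqI gate_computes.sum[OF assms]) auto
  then show ?thesis
    using Sum_less[OF assms] assms by (simp add: coef_def lookup_add)
qed

lemma gate_poly_Prod:
  assumes "i < S" "gates \<Psi> ! i = Prod j k"
  shows "gate_poly i = np_mult (gate_poly j) (gate_poly k)"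
  using Prod_less[OF assms] gate_computes_gate_poly
  by (intro gate_poly_eqI gate_computes.prod[OF assms]) auto

section \<open>Linear systems along the wires\<close>

abbreviation const_coef :: "nat \<Rightarrow> 'a" where
  "const_coef \<equiv> coef MOne"

text \<open>The part of the recursion for a tree coefficient that refers to the same tree at the
  children. At a product gate these are the factorizations with a factor
  \<open>MOne\<close>.\<close>

definition linear_part :: "(nat \<Rightarrow> 'a) \<Rightarrow> nat \<Rightarrow> 'a" where
  "linear_part v i = (case gates \<Psi> ! i of
      Var _ \<Rightarrow> 0 | Const _ \<Rightarrow> 0 | Sum j k \<Rightarrow> v j + v k
    | Prod j k \<Rightarrow> const_coef j * v k + const_coef k * v j)"

lemma linear_part_cong:
  "(\<And>j. j \<in> children (gates \<Psi> ! i) \<Longrightarrow> v j = w j) \<Longrightarrow> linear_part v i = linear_part w i"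
  by (cases "gates \<Psi> ! i") (auto simp: linear_part_def)

definition solves :: "(nat \<Rightarrow> 'a) \<Rightarrow> (nat \<Rightarrow> 'a) \<Rightarrow> bool" where
  "solves src v \<longleftrightarrow> (\<forall>i. v i = (if i < S then linear_part v i + src i else 0))"

text \<open>The system is triangular along the wires: the values at the children determine the value
  at a gate.\<close>

lemma solves_unique:
  assumes "solves src v" "solves src w"
  shows "v = w"
proof
  fix i
  have "i < S \<Longrightarrow> v i = w i"
  proof (induction rule: gate_induct)
    case (gate i)
    then have "linear_part v i = linear_part w i"
      by (intro linear_part_cong)
    then show ?case
      using assms gate(1) by (simp add: solves_def)
  qed
  then show "v i = w i"
    using assms by (cases "i < S") (simp_all add: solves_def)
qed

lemma solves_ex: "\<exists>v. solves src v"
proof -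
  define F where "F v i = (if i < S then linear_part v i + src i else 0)" for v i
  \<comment> \<open>Jacobi iteration from the zero vector: after \<open>k\<close> steps the gates of
    rank below \<open>k\<close> no longer change.\<close>
  have stable: "i < S \<Longrightarrow> rank i < k \<Longrightarrow> F ((F ^^ k) (\<lambda>_. 0)) i = (F ^^ k) (\<lambda>_. 0) i" for k i
  proof (induction k arbitrary: i)
    case (Suc k)
    have "linear_part (F ((F ^^ k) (\<lambda>_. 0))) i = linear_part ((F ^^ k) (\<lambda>_. 0)) i"
      using Suc.prems rank_child[OF Suc.prems(1)] children_less[OF Suc.prems(1)]
      by (intro linear_part_cong Suc.IH) force+
    then show ?case
      using Suc.prems(1) by (simp add: F_def[of "F ((F ^^ k) (\<lambda>_. 0))"] F_def[of "(F ^^ k) (\<lambda>_. 0)" i])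
  qed simp
  \<comment> \<open>\<open>S\<close> iterations already reach every rank; the outermost one shows at
    once that \<open>v\<close> vanishes outside the circuit.\<close>
  define v where "v = (F ^^ Suc S) (\<lambda>_. 0)"
  have "F v i = v i" if "i < S" for i
    unfolding v_def by (rule stable) (use rank_less[OF that] that in auto)
  moreover have "v i = 0" if "\<not> i < S" for i
    unfolding v_def using that by (simp add: F_def)
  ultimately have "solves src v"
    unfolding solves_def F_def by metis
  then show ?thesis by blast
qed

definition solution :: "(nat \<Rightarrow> 'a) \<Rightarrow> nat \<Rightarrow> 'a" where
  "solution src = (THE v. solves src v)"

lemma solution_eqI: "solves src v \<Longrightarrow> solution src = v"
  unfolding solution_def using solves_unique by blast

lemma solves_solution: "solves src (solution src)"
  using solves_ex solution_eqI by blast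

lemma solution_eq: "i < S \<Longrightarrow> solution src i = linear_part (solution src) i + src i"
  and solution_ge: "\<not> i < S \<Longrightarrow> solution src i = 0"
  using solves_solution[of src, unfolded solves_def, rule_format, of i] by simp_all

lemma solution_add: "solution (a + b) = solution a + solution b"
proof (rule solution_eqI, unfold solves_def, intro allI)
  fix i
  have "linear_part (solution a + solution b) i =
      linear_part (solution a) i + linear_part (solution b) i"
    by (cases "gates \<Psi> ! i") (auto simp: linear_part_def algebra_simps)
  then show "(solution a + solution b) i =
      (if i < S then linear_part (solution a + solution b) i + (a + b) i else 0)"
    by (auto simp: solution_eq solution_ge)
qed

lemma solution_scale: "solution (\<lambda>i. c * a i) = (\<lambda>i. c * solution a i)"
proof (rule solution_eqI, unfold solves_def, intro allI)
  fix i
  have "linear_part (\<lambda>i. c * solution a i) i = c * linear_part (solution a) i"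
    by (cases "gates \<Psi> ! i") (auto simp: linear_part_def algebra_simps)
  then show "c * solution a i =
      (if i < S then linear_part (\<lambda>i. c * solution a i) i + c * a i else 0)"
    by (auto simp: solution_eq solution_ge distrib_left)
qed

section \<open>The vectors of trees as solutions\<close>

definition leaf_source :: "nat \<Rightarrow> nat \<Rightarrow> 'a" where
  "leaf_source x i = (if gates \<Psi> ! i = Var x then 1 else 0)"

text \<open>The two summands are the two ways to distribute distinct subtrees over the factors of a
  product gate; \<open>square_source\<close> keeps the single way for equal subtrees.\<close>

definition cross_source :: "(nat \<Rightarrow> 'a) \<Rightarrow> (nat \<Rightarrow> 'a) \<Rightarrow> nat \<Rightarrow> 'a" where
  "cross_source v w i =
    (case gates \<Psi> ! i of Prod j k \<Rightarrow> v j * w k + v k * w j | _ \<Rightarrow> 0)"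

definition square_source :: "(nat \<Rightarrow> 'a) \<Rightarrow> nat \<Rightarrow> 'a" where
  "square_source v i = (case gates \<Psi> ! i of Prod j k \<Rightarrow> v j * v k | _ \<Rightarrow> 0)"

abbreviation tree_vec :: "ctree \<Rightarrow> nat \<Rightarrow> 'a" where
  "tree_vec t \<equiv> coef (MTree t)"

definition cross :: "(nat \<Rightarrow> 'a) \<Rightarrow> (nat \<Rightarrow> 'a) \<Rightarrow> nat \<Rightarrow> 'a" where
  "cross v w = solution (cross_source v w)"

definition square :: "(nat \<Rightarrow> 'a) \<Rightarrow> nat \<Rightarrow> 'a" where
  "square v = solution (square_source v)"

lemma solves_coefI:
  assumes "\<And>i. i < S \<Longrightarrow> coef m i = linear_part (coef m) i + src i"
  shows "coef m = solution src"
  using assms by (intro solution_eqI[symmetric]) (auto simp: solves_def coef_def)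

lemma tree_vec_Leaf: "tree_vec (Leaf x) = solution (leaf_source x)"
proof (rule solves_coefI)
  fix i assume i: "i < S"
  show "tree_vec (Leaf x) i = linear_part (tree_vec (Leaf x)) i + leaf_source x i"
  proof (cases "gates \<Psi> ! i")
    case (Prod j k)
    then show ?thesis
      using i Prod_less[OF i Prod] gate_poly_Prod[OF i Prod]
      by (simp add: linear_part_def leaf_source_def coef_def lookup_np_mult_Leaf)
  qed (use i in \<open>auto simp: linear_part_def leaf_source_def coef_Var coef_Const coef_Sum\<close>)
qed

text \<open>The source is the last summand of \<open>lookup_np_mult_Node\<close>, and it occurs at
  product gates only. The case distinction concerns the trees, not their vectors: distinct trees
  with equal vectors fall under \<open>cross\<close>.\<close>

lemma tree_vec_Node:
  "tree_vec (Node (Upair t u)) =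
    (if t = u then square (tree_vec t) else cross (tree_vec t) (tree_vec u))"
proof -
  have "tree_vec (Node (Upair t u)) = solution
    (if t = u then square_source (tree_vec t) else cross_source (tree_vec t) (tree_vec u))"
  proof (rule solves_coefI)
    fix i assume i: "i < S"
    show "tree_vec (Node (Upair t u)) i = linear_part (tree_vec (Node (Upair t u))) i +
      (if t = u then square_source (tree_vec t) else cross_source (tree_vec t) (tree_vec u)) i"
    proof (cases "gates \<Psi> ! i")
      case (Prod j k)
      then show ?thesis
        using i Prod_less[OF i Prod] gate_poly_Prod[OF i Prod]
        by (simp add: linear_part_def cross_source_def square_source_def coef_def
            lookup_np_mult_Node)
    qed (use i in \<open>auto simp: linear_part_def cross_source_def square_source_def
          coef_Var coef_Const coef_Sum\<close>)
  qed
  then show ?thesis by (simp add: square_def cross_def)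
qed

end

section \<open>Incremental Gaussian elimination\<close>

interpretation fn: vector_space "\<lambda>(c::'a::field) (v::nat \<Rightarrow> 'a) i. c * v i"
  by standard (auto simp: fun_eq_iff algebra_simps)

lemma fn_subspaceI:
  assumes "(\<lambda>_. 0) \<in> V" "\<And>v w. v \<in> V \<Longrightarrow> w \<in> V \<Longrightarrow> v + w \<in> V"
    "\<And>c v. v \<in> V \<Longrightarrow> (\<lambda>i. c * v i) \<in> V"
  shows "fn.subspace V"
  using assms by (auto simp: fn.subspace_def zero_fun_def)

lemma fn_span_zero: "(\<lambda>_. 0) \<in> fn.span V"
  using fn.span_zero[of V] by (simp add: zero_fun_def)

text \<open>
  Row \<open>p\<close> of an echelon matrix is either zero or has its pivot in column \<open>p\<close>, so that the number
  of rows does not change when vectors are inserted.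
\<close>

definition echelon :: "nat \<Rightarrow> (nat \<Rightarrow> nat \<Rightarrow> 'a::field) \<Rightarrow> bool" where
  "echelon m B \<longleftrightarrow> (\<forall>p. (B p p = 0 \<longrightarrow> B p = (\<lambda>_. 0)) \<and> (\<forall>i. i < p \<or> m \<le> i \<longrightarrow> B p i = 0))"

text \<open>Elimination never alters a row that has a pivot; it only fills zero rows. This makes
  spans grow and progress countable.\<close>

definition extends :: "(nat \<Rightarrow> nat \<Rightarrow> 'a::field) \<Rightarrow> (nat \<Rightarrow> nat \<Rightarrow> 'a) \<Rightarrow> bool" where
  "extends B B' \<longleftrightarrow> (\<forall>p. B p p \<noteq> 0 \<longrightarrow> B' p = B p)"

text \<open>Its cardinality replaces the dimension of the row space, so that no argument about
  linear independence enters.\<close>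

definition pivots :: "nat \<Rightarrow> (nat \<Rightarrow> nat \<Rightarrow> 'a::field) \<Rightarrow> nat set" where
  "pivots m B = {p. p < m \<and> B p p \<noteq> 0}"

definition add_row ::
  "nat \<Rightarrow> (nat \<Rightarrow> nat \<Rightarrow> 'a::field) \<Rightarrow> (nat \<Rightarrow> 'a) \<Rightarrow> nat \<Rightarrow> nat \<Rightarrow> 'a" where
  "add_row l B w = (if w l \<noteq> 0 \<and> B l l = 0 then B(l := w) else B)"

text \<open>If \<open>b l = 0\<close>, division by zero makes the factor 0 and \<open>w\<close>
  stays as it is. In \<open>reduce\<close> this happens only when \<open>w l\<close> is already 0,
  since otherwise \<open>add_row\<close> would have filled the row.\<close>

definition clear :: "(nat \<Rightarrow> 'a::field) \<Rightarrow> nat \<Rightarrow> (nat \<Rightarrow> 'a) \<Rightarrow> nat \<Rightarrow> 'a" where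
  "clear b l w i = w i - w l / b l * b i"

text \<open>There is no early exit: once \<open>w\<close> has become a row, \<open>clear\<close>
  subtracts it from itself, and the zero vector passes unchanged through the remaining
  columns.\<close>

primrec reduce ::
  "nat \<Rightarrow> (nat \<Rightarrow> nat \<Rightarrow> 'a::field) \<times> (nat \<Rightarrow> 'a) \<Rightarrow> (nat \<Rightarrow> nat \<Rightarrow> 'a) \<times> (nat \<Rightarrow> 'a)" where
  "reduce 0 Bw = Bw"
| "reduce (Suc l) Bw = (let (B, w) = reduce l Bw; B' = add_row l B w in (B', clear (B' l) l w))"

lemma extends_refl: "extends B B"
  by (simp add: extends_def)

lemma extends_trans: "extends A B \<Longrightarrow> extends B C \<Longrightarrow> extends A C"
  by (auto simp: extends_def)

lemma extends_span:
  assumes "echelon m B" "extends B B'"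
  shows "fn.span (range B) \<subseteq> fn.span (range B')"
proof (rule fn.span_minimal)
  show "range B \<subseteq> fn.span (range B')"
  proof clarify
    fix p
    show "B p \<in> fn.span (range B')"
    proof (cases "B p p = 0")
      case True
      then have "B p = (\<lambda>_. 0)" using assms(1) unfolding echelon_def by blast
      then show ?thesis by (simp only: fn_span_zero)
    next
      case False
      then have "B p = B' p" using assms(2) by (simp add: extends_def)
      then show ?thesis using fn.span_base[of "B' p" "range B'"] by simp
    qed
  qed
qed simp

lemma finite_pivots: "finite (pivots m B)"
  by (simp add: pivots_def)

lemma card_pivots_le: "card (pivots m B) \<le> m"
  using card_mono[of "{..<m}" "pivots m B"] by (auto simp: pivots_def)

lemma extends_pivots: "extends B B' \<Longrightarrow> pivots m B \<subseteq> pivots m B'"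
  by (auto simp: extends_def pivots_def)

text \<open>The pivot sets are nested, so equal cardinality makes them equal. A row without pivot in
  \<open>B\<close> then has none in \<open>B'\<close>, and \<open>echelon\<close> makes both rows
  zero.\<close>

lemma extends_eq_or_more_pivots:
  assumes "echelon m B" "echelon m B'" "extends B B'"
  shows "B' = B \<or> card (pivots m B) < card (pivots m B')"
proof (rule disjCI)
  assume "\<not> card (pivots m B) < card (pivots m B')"
  then have eq: "pivots m B = pivots m B'"
    using extends_pivots[OF assms(3)] finite_pivots card_seteq by (metis not_le)
  show "B' = B"
  proof
    fix p
    show "B' p = B p"
    proof (cases "B p p = 0")
      case True
      then have "B' p p = 0"
        using eq assms(2) by (cases "p < m") (auto simp: pivots_def echelon_def)
      then show ?thesis using True assms(1,2) by (simp add: echelon_def)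
    next
      case False
      then show ?thesis using assms(3) by (simp add: extends_def)
    qed
  qed
qed

lemma add_row_echelon:
  assumes "echelon m B" "\<And>i. i < l \<or> m \<le> i \<Longrightarrow> w i = 0"
  shows "echelon m (add_row l B w)"
  using assms by (auto simp: echelon_def add_row_def)

lemma add_row_extends: "extends B (add_row l B w)"
  by (auto simp: extends_def add_row_def)

text \<open>Column \<open>l\<close> is cleared in each case: by an old pivot, by \<open>w\<close>
  itself as the new row, or because \<open>w l\<close> was 0. The other columns concerned are zero
  both in \<open>w\<close> and in row \<open>l\<close>.\<close>

lemma clear_upto:
  assumes "echelon m B" "\<And>i. i < l \<or> m \<le> i \<Longrightarrow> w i = 0" "i < Suc l \<or> m \<le> i"
  shows "clear (add_row l B w l) l w i = 0"
proof (cases "i = l")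
  case True
  then show ?thesis by (auto simp: clear_def add_row_def)
next
  case False
  then have "i < l \<or> m \<le> i" using assms(3) by auto
  then show ?thesis
    using assms(2)[of i] add_row_echelon[of m B l w, OF assms(1,2)]
    by (auto simp: clear_def echelon_def)
qed

text \<open>All that is subtracted from \<open>w\<close> is a multiple of some row. At
  \<open>l = m\<close> the remainder is 0, and the last clause says that \<open>w\<close> lies in
  the new span.\<close>

lemma reduce_invariant:
  assumes "echelon m B" "\<And>i. m \<le> i \<Longrightarrow> w i = 0" "reduce l (B, w) = (B', w')"
  shows "echelon m B' \<and> extends B B' \<and> (\<forall>i. i < l \<or> m \<le> i \<longrightarrow> w' i = 0) \<and>
    w - w' \<in> fn.span (range B')"
  using assms(3)
proof (induction l arbitrary: B' w')
  case 0
  then show ?case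
    using assms extends_refl fn_span_zero by (auto simp: fun_diff_def)
next
  case (Suc l)
  obtain B1 w1 where 1: "reduce l (B, w) = (B1, w1)" by fastforce
  note IH = Suc.IH[OF 1]
  have B': "B' = add_row l B1 w1" and w': "w' = clear (B' l) l w1"
    using Suc.prems 1 by (auto simp: Let_def)
  have ech: "echelon m B'" unfolding B' by (rule add_row_echelon) (use IH in auto)
  have ext: "extends B1 B'" unfolding B' by (rule add_row_extends)
  have "w' i = 0" if "i < Suc l \<or> m \<le> i" for i
    unfolding w' B' by (rule clear_upto) (use IH that in auto)
  moreover have "w - w' \<in> fn.span (range B')"
  proof -
    have "w - w' = (w - w1) + (\<lambda>i. w1 l / B' l l * B' l i)"
      by (auto simp: w' clear_def fun_eq_iff)
    moreover have "w - w1 \<in> fn.span (range B')"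
      using IH extends_span[OF _ ext] by blast
    moreover have "(\<lambda>i. w1 l / B' l l * B' l i) \<in> fn.span (range B')"
      by (intro fn.span_scale fn.span_base) simp
    ultimately show ?thesis by (simp only: fn.span_add)
  qed
  ultimately show ?case
    using ech ext IH extends_trans by blast
qed

text \<open>The soundness half: elimination produces nothing outside a subspace that contains the
  rows and the inserted vector.\<close>

lemma reduce_subspace:
  assumes "fn.subspace V" "range B \<subseteq> V" "w \<in> V" "reduce l (B, w) = (B', w')"
  shows "range B' \<subseteq> V \<and> w' \<in> V"
  using assms(4)
proof (induction l arbitrary: B' w')
  case 0
  then show ?case using assms by simp
next
  case (Suc l)
  obtain B1 w1 where 1: "reduce l (B, w) = (B1, w1)" by fastforce
  note IH = Suc.IH[OF 1]
  have B': "B' = add_row l B1 w1" and w': "w' = clear (B' l) l w1"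
    using Suc.prems 1 by (auto simp: Let_def)
  have B'V: "range B' \<subseteq> V" using IH by (auto simp: B' add_row_def)
  have eq: "w' = w1 - (\<lambda>i. w1 l / B' l l * B' l i)"
    by (auto simp: w' clear_def fun_eq_iff)
  have "(\<lambda>i. w1 l / B' l l * B' l i) \<in> V"
    using B'V by (intro fn.subspace_scale[OF assms(1)]) auto
  then have "w' \<in> V"
    unfolding eq using IH by (intro fn.subspace_diff[OF assms(1)]) auto
  with B'V show ?case by blast
qed

definition insert_vec ::
  "nat \<Rightarrow> (nat \<Rightarrow> nat \<Rightarrow> 'a::field) \<Rightarrow> (nat \<Rightarrow> 'a) \<Rightarrow> nat \<Rightarrow> nat \<Rightarrow> 'a" where
  "insert_vec m B w = fst (reduce m (B, w))"

lemma insert_vec: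
  assumes "echelon m B" "\<And>i. m \<le> i \<Longrightarrow> w i = 0"
  shows insert_vec_echelon: "echelon m (insert_vec m B w)"
    and insert_vec_extends: "extends B (insert_vec m B w)"
    and insert_vec_span: "w \<in> fn.span (range (insert_vec m B w))"
proof -
  obtain B' w' where r: "reduce m (B, w) = (B', w')" by fastforce
  note inv = reduce_invariant[OF assms r]
  show "echelon m (insert_vec m B w)" "extends B (insert_vec m B w)"
    using inv by (simp_all add: insert_vec_def r)
  have "w' = (\<lambda>_. 0)" using inv by (auto simp: fun_eq_iff)
  then have "w - w' = w" by (simp add: fun_eq_iff)
  then show "w \<in> fn.span (range (insert_vec m B w))"
    using inv by (simp add: insert_vec_def r)
qed

lemma insert_vec_subspace:
  assumes "fn.subspace V" "range B \<subseteq> V" "w \<in> V"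
  shows "range (insert_vec m B w) \<subseteq> V"
  using reduce_subspace[OF assms, of m] by (cases "reduce m (B, w)") (simp add: insert_vec_def)

section \<open>The space of coefficient vectors\<close>

context valid_circuit
begin

section \<open>Bilinearity, polarization and closure of spans\<close>

lemma cross_add_left: "cross (a + b) w = cross a w + cross b w"
proof -
  have "cross_source (a + b) w = cross_source a w + cross_source b w"
    by (rule ext) (auto simp: cross_source_def algebra_simps split: gate.split)
  then show ?thesis by (simp add: cross_def solution_add)
qed

lemma cross_scale_left: "cross (\<lambda>i. c * a i) w = (\<lambda>i. c * cross a w i)"
proof -
  have "cross_source (\<lambda>i. c * a i) w = (\<lambda>i. c * cross_source a w i)"
    by (rule ext) (auto simp: cross_source_def algebra_simps split: gate.split)
  then show ?thesis by (simp add: cross_def solution_scale)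
qed

lemma cross_commute: "cross v w = cross w v"
proof -
  have "cross_source v w = cross_source w v"
    by (rule ext) (auto simp: cross_source_def algebra_simps split: gate.split)
  then show ?thesis by (simp add: cross_def)
qed

text \<open>The right-hand side is zero in characteristic 2, hence \<open>square\<close> has to be a
  map of its own.\<close>

lemma cross_self: "cross v v = square v + square v"
proof -
  have "cross_source v v = square_source v + square_source v"
    by (rule ext) (auto simp: cross_source_def square_source_def algebra_simps split: gate.split)
  then show ?thesis by (simp only: cross_def square_def solution_add)
qed

text \<open>Allows diagonal pairs to contribute only their square: \<open>cross v v\<close> follows
  from it in every characteristic.\<close>

lemma cross_self_span: "square v \<in> fn.span X \<Longrightarrow> cross v v \<in> fn.span X"
proof -
  assume "square v \<in> fn.span X"
  then show ?thesis unfolding cross_self by (intro fn.span_add)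
qed

lemma square_add: "square (v + w) = square v + square w + cross v w"
proof -
  have "square_source (v + w) = square_source v + square_source w + cross_source v w"
    by (rule ext) (auto simp: cross_source_def square_source_def algebra_simps split: gate.split)
  then show ?thesis by (simp add: cross_def square_def solution_add)
qed

lemma square_scale: "square (\<lambda>i. c * v i) = (\<lambda>i. (c * c) * square v i)"
proof -
  have "square_source (\<lambda>i. c * v i) = (\<lambda>i. (c * c) * square_source v i)"
    by (rule ext) (auto simp: square_source_def algebra_simps split: gate.split)
  then show ?thesis by (simp add: square_def solution_scale)
qed

lemma cross_zero: "cross (\<lambda>_. 0) w = (\<lambda>_. 0)"
  using cross_scale_left[of 0 "\<lambda>_. 0" w] by simp

lemma square_zero: "square (\<lambda>_. 0) = (\<lambda>_. 0)"
  using square_scale[of 0 "\<lambda>_. 0"] by simp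

lemma cross_ge: "S \<le> i \<Longrightarrow> cross v w i = 0"
  and square_ge: "S \<le> i \<Longrightarrow> square v i = 0"
  by (simp_all add: cross_def square_def solution_ge)

lemma cross_span:
  assumes "\<And>v w. v \<in> X \<Longrightarrow> w \<in> X \<Longrightarrow> cross v w \<in> fn.span Y"
    and "v \<in> fn.span X" "w \<in> fn.span X"
  shows "cross v w \<in> fn.span Y"
proof -
  have sub: "fn.subspace {v. cross v w \<in> fn.span Y}" for w
    by (rule fn_subspaceI)
      (auto simp: cross_zero fn_span_zero cross_add_left cross_scale_left
        intro: fn.span_add fn.span_scale)
  \<comment> \<open>The first argument stays in \<open>X\<close> while the second runs through the
    span. By symmetry the subspace \<open>sub\<close> for first arguments serves this stage as
    well.\<close>
  have "cross v w \<in> fn.span Y" if "v \<in> X" for v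
  proof -
    have "fn.span X \<subseteq> {w. cross w v \<in> fn.span Y}"
      by (rule fn.span_minimal[OF _ sub]) (use assms(1) that in auto)
    then show ?thesis using assms(3) cross_commute[of v w] by auto
  qed
  then have "fn.span X \<subseteq> {v. cross v w \<in> fn.span Y}"
    by (intro fn.span_minimal[OF _ sub]) auto
  then show ?thesis using assms(2) by auto
qed

lemma square_span:
  assumes "\<And>v w. v \<in> X \<Longrightarrow> w \<in> X \<Longrightarrow> cross v w \<in> fn.span X"
    and "\<And>v. v \<in> X \<Longrightarrow> square v \<in> fn.span X" and "v \<in> fn.span X"
  shows "square v \<in> fn.span X"
proof -
  \<comment> \<open>Vectors with square in the span need not form a subspace by themselves.
    Restricting them to \<open>fn.span X\<close> puts the mixed term \<open>cross v w\<close> of a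
    sum into the span.\<close>
  have "fn.subspace {v \<in> fn.span X. square v \<in> fn.span X}"
    by (rule fn_subspaceI)
      (auto simp: square_zero fn_span_zero square_add square_scale
        intro: fn.span_add fn.span_scale cross_span[OF assms(1)])
  then have "fn.span X \<subseteq> {v \<in> fn.span X. square v \<in> fn.span X}"
    by (intro fn.span_minimal) (use assms(2) fn.span_base in auto)
  then show ?thesis using assms(3) by auto
qed

section \<open>The span of all tree vectors\<close>

definition coef_space :: "(nat \<Rightarrow> 'a) set" where
  "coef_space = fn.span (range tree_vec)"

lemma coef_space_square_cross:
  "v \<in> coef_space \<Longrightarrow> square v \<in> coef_space"
  "v \<in> coef_space \<Longrightarrow> w \<in> coef_space \<Longrightarrow> cross v w \<in> coef_space"
proof -
  have sq: "square (tree_vec t) \<in> coef_space" for t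
    unfolding coef_space_def
    by (rule fn.span_base) (metis rangeI tree_vec_Node)
  have cr: "cross (tree_vec t) (tree_vec u) \<in> coef_space" for t u
  proof (cases "t = u")
    case True
    then show ?thesis using sq[of u] by (simp add: cross_self_span coef_space_def)
  next
    case False
    then show ?thesis
      unfolding coef_space_def
      by (intro fn.span_base) (metis rangeI tree_vec_Node)
  qed
  show "cross v w \<in> coef_space" if "v \<in> coef_space" "w \<in> coef_space"
    unfolding coef_space_def
    by (rule cross_span[of "range tree_vec"]) (use cr that in \<open>auto simp: coef_space_def\<close>)
  show "square v \<in> coef_space" if "v \<in> coef_space"
    unfolding coef_space_def
    by (rule square_span) (use sq cr that in \<open>auto simp: coef_space_def\<close>)
qed

text \<open>Variables from \<open>n\<close> on label no gate, so finitely many leaf vectors generate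
  the contribution of all leaves.\<close>

lemma tree_vec_Leaf_ge:
  assumes "n \<le> x"
  shows "tree_vec (Leaf x) = (\<lambda>_. 0)"
  unfolding tree_vec_Leaf
proof (rule solution_eqI, unfold solves_def, intro allI)
  fix i
  have "gates \<Psi> ! i \<noteq> Var x" if "i < S"
    using Var_less[OF that, of x] assms by auto
  then show "0 = (if i < S then linear_part (\<lambda>_. 0) i + leaf_source x i else 0)"
    by (auto simp: leaf_source_def linear_part_def split: gate.split)
qed

definition pair_vec :: "(nat \<Rightarrow> nat \<Rightarrow> 'a) \<Rightarrow> nat \<Rightarrow> nat \<Rightarrow> nat \<Rightarrow> 'a" where
  "pair_vec B p q = (if p = q then square (B p) else cross (B p) (B q))"

text \<open>The completeness criterion. Closure of the rows under both maps extends to their span,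
  and induction on trees then reaches every tree vector.\<close>

lemma coef_space_subset:
  assumes "echelon S B"
    and leaf: "\<And>x. x < n \<Longrightarrow> tree_vec (Leaf x) \<in> fn.span (range B)"
    and pair: "\<And>p q. p < S \<Longrightarrow> q < S \<Longrightarrow> pair_vec B p q \<in> fn.span (range B)"
  shows "coef_space \<subseteq> fn.span (range B)"
proof -
  let ?V = "fn.span (range B)"
  \<comment> \<open>From row \<open>S\<close> on the pivot column lies outside the matrix, so
    \<open>echelon\<close> forces the row to be zero; only pairs below \<open>S\<close> remain to be
    inspected.\<close>
  have zero: "B p = (\<lambda>_. 0)" if "\<not> p < S" for p
    using assms(1) that by (auto simp: echelon_def)
  have sq: "square (B p) \<in> ?V" for p
    using pair[of p p] zero[of p]
    by (cases "p < S") (auto simp: pair_vec_def square_zero fn_span_zero)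
  have cr: "cross (B p) (B q) \<in> ?V" for p q
  proof (cases "p = q")
    case True
    then show ?thesis using sq[of q] by (simp add: cross_self_span)
  next
    case False
    then show ?thesis
      using pair[of p q] zero[of p] zero[of q] cross_commute[of "B p" "B q"]
      by (cases "p < S"; cases "q < S") (auto simp: pair_vec_def cross_zero fn_span_zero)
  qed
  have "tree_vec t \<in> ?V" for t
  proof (induction t)
    case (Leaf x)
    then show ?case
      using leaf[of x] tree_vec_Leaf_ge[of x] fn_span_zero by (cases "x < n") auto
  next
    case (Node p)
    obtain t u where p: "p = Upair t u" by (cases p)
    have tu: "tree_vec t \<in> ?V" "tree_vec u \<in> ?V"
      using Node[of t] Node[of u] by (auto simp: p)
    have "square (tree_vec t) \<in> ?V"
      by (rule square_span[OF _ _ tu(1)]) (use sq cr in auto)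
    moreover have "cross (tree_vec t) (tree_vec u) \<in> ?V"
      by (rule cross_span[OF _ tu]) (use cr in auto)
    ultimately show ?case by (cases "t = u") (simp_all add: p tree_vec_Node)
  qed
  then show ?thesis
    unfolding coef_space_def by (intro fn.span_minimal) auto
qed

section \<open>Growth of the basis by rounds\<close>

definition sound_basis :: "(nat \<Rightarrow> nat \<Rightarrow> 'a) \<Rightarrow> bool" where
  "sound_basis B \<longleftrightarrow> echelon S B \<and> range B \<subseteq> coef_space"

lemma sound_basis_insert:
  assumes "sound_basis B" "w \<in> coef_space" "\<And>i. S \<le> i \<Longrightarrow> w i = 0"
  shows "sound_basis (insert_vec S B w)"
  using assms insert_vec_echelon[of S B w] insert_vec_subspace[of coef_space B w S]
  by (auto simp: sound_basis_def coef_space_def)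

lemma pair_vec_in_coef_space: "sound_basis B \<Longrightarrow> pair_vec B p q \<in> coef_space"
  unfolding sound_basis_def pair_vec_def
  by (simp add: coef_space_square_cross image_subset_iff)

lemma pair_vec_ge: "S \<le> i \<Longrightarrow> pair_vec B p q i = 0"
  by (simp add: pair_vec_def cross_ge square_ge)

text \<open>\<open>B0\<close> is the matrix at the start of the round and \<open>Z\<close> the set
  of processed pairs. A row filled during the round invalidates pairs formed earlier from that row
  when it was zero, so after a gain of pivots nothing is claimed about \<open>Z\<close>.\<close>

definition round_invariant ::
  "(nat \<Rightarrow> nat \<Rightarrow> 'a) \<Rightarrow> (nat \<Rightarrow> nat \<Rightarrow> 'a) \<Rightarrow> (nat \<times> nat) set \<Rightarrow> bool" where
  "round_invariant B0 B Z \<longleftrightarrow> sound_basis B \<and> extends B0 B \<and>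
    (card (pivots S B0) < card (pivots S B) \<or>
     B = B0 \<and> (\<forall>(p, q)\<in>Z. pair_vec B p q \<in> fn.span (range B)))"

lemma round_invariant_start: "sound_basis B \<Longrightarrow> round_invariant B B {}"
  by (simp add: round_invariant_def extends_refl)

lemma round_invariant_insert:
  assumes "round_invariant B0 B Z"
  shows "round_invariant B0 (insert_vec S B (pair_vec B p q)) (insert (p, q) Z)"
proof -
  let ?w = "pair_vec B p q"
  let ?B' = "insert_vec S B ?w"
  have B: "sound_basis B" "extends B0 B"
    using assms by (auto simp: round_invariant_def)
  have ech: "echelon S B" "echelon S ?B'" and ext: "extends B ?B'"
    and span: "?w \<in> fn.span (range ?B')"
    using B(1) by (auto simp: sound_basis_def pair_vec_ge
        intro: insert_vec_echelon insert_vec_extends insert_vec_span)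
  have sound: "sound_basis ?B'"
    using B(1) by (intro sound_basis_insert pair_vec_in_coef_space pair_vec_ge)
  from extends_eq_or_more_pivots[OF ech ext] show ?thesis
  proof
    \<comment> \<open>An insertion that changes nothing certifies that the inserted vector was
      already in the span.\<close>
    assume "?B' = B"
    with assms span show ?thesis by (auto simp: round_invariant_def)
  next
    assume more: "card (pivots S B) < card (pivots S ?B')"
    have "card (pivots S B0) \<le> card (pivots S B)"
      using extends_pivots[OF B(2)] finite_pivots by (intro card_mono)
    with more sound B(2) ext show ?thesis
      using extends_trans by (auto simp: round_invariant_def)
  qed
qed

text \<open>\<open>r\<close> counts the completed rounds. As there are at most \<open>S\<close>
  pivots, \<open>r = Suc S\<close> excludes the second alternative.\<close>

definition saturated :: "nat \<Rightarrow> (nat \<Rightarrow> nat \<Rightarrow> 'a) \<Rightarrow> bool" where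
  "saturated r B \<longleftrightarrow> sound_basis B \<and> (\<forall>x<n. tree_vec (Leaf x) \<in> fn.span (range B)) \<and>
    (coef_space \<subseteq> fn.span (range B) \<or> r \<le> card (pivots S B))"

text \<open>Without a gain the matrix is unchanged and all its pairs lie in its span, so it is
  complete. With a gain the lower bound on the pivots rises by one, and completeness reached earlier
  persists.\<close>

lemma saturated_round:
  assumes "saturated r B0" "round_invariant B0 B ({..<S} \<times> {..<S})"
  shows "saturated (Suc r) B"
proof -
  have B: "sound_basis B" "extends B0 B" "echelon S B" "echelon S B0"
    using assms by (auto simp: round_invariant_def saturated_def sound_basis_def)
  have span: "fn.span (range B0) \<subseteq> fn.span (range B)"
    using extends_span[OF B(4,2)] .
  have leaf: "\<And>x. x < n \<Longrightarrow> tree_vec (Leaf x) \<in> fn.span (range B)"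
    using assms(1) span by (auto simp: saturated_def)
  have "coef_space \<subseteq> fn.span (range B) \<or> Suc r \<le> card (pivots S B)"
  proof (cases "card (pivots S B0) < card (pivots S B)")
    case True
    then show ?thesis using assms(1) span by (auto simp: saturated_def)
  next
    case False
    then have "pair_vec B p q \<in> fn.span (range B)" if "p < S" "q < S" for p q
      using assms(2) that by (auto simp: round_invariant_def)
    then show ?thesis using coef_space_subset[OF B(3) leaf] by blast
  qed
  then show ?thesis using B leaf by (auto simp: saturated_def)
qed

lemma zero_iff:
  assumes "saturated (Suc S) B" "circuit_computes \<Psi> f"
  shows "f = 0 \<longleftrightarrow> const_coef (out \<Psi>) = 0 \<and> (\<forall>p<S. B p (out \<Psi>) = 0)"
proof -
  have f: "coef m (out \<Psi>) = Poly_Mapping.lookup f m" for m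
    using assms(2) gate_poly_eqI out_less by (simp add: circuit_computes_def coef_def)
  have sound: "sound_basis B" and full: "coef_space \<subseteq> fn.span (range B)"
    using assms(1) card_pivots_le[of S B] by (auto simp: saturated_def)
  \<comment> \<open>Vanishing at the output is a linear condition. It passes from the tree vectors
    to the rows by soundness and back by completeness.\<close>
  have sub: "fn.subspace {v. v (out \<Psi>) = 0}"
    by (rule fn_subspaceI) auto
  show ?thesis
  proof
    assume "f = 0"
    then have "coef_space \<subseteq> {v. v (out \<Psi>) = 0}"
      unfolding coef_space_def by (intro fn.span_minimal[OF _ sub]) (auto simp: f)
    with sound \<open>f = 0\<close> show "const_coef (out \<Psi>) = 0 \<and> (\<forall>p<S. B p (out \<Psi>) = 0)"
      by (auto simp: sound_basis_def f)
  next
    assume *: "const_coef (out \<Psi>) = 0 \<and> (\<forall>p<S. B p (out \<Psi>) = 0)"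
    have "B p (out \<Psi>) = 0" for p
      using * sound out_less by (cases "p < S") (auto simp: sound_basis_def echelon_def)
    then have "fn.span (range B) \<subseteq> {v. v (out \<Psi>) = 0}"
      by (intro fn.span_minimal[OF _ sub]) auto
    then have "tree_vec t (out \<Psi>) = 0" for t
      using full fn.span_base[of "tree_vec t" "range tree_vec"] by (auto simp: coef_space_def)
    then have "Poly_Mapping.lookup f m = 0" for m
      using * by (cases m) (auto simp: f)
    then show "f = 0" by (intro poly_mapping_eqI) simp
  qed
qed

end

section \<open>Reasoning about programs\<close>

definition runs ::
  "com \<Rightarrow> 'a::field store \<Rightarrow> nat \<Rightarrow> ('a store \<Rightarrow> bool) \<Rightarrow> bool" where
  "runs c s T Q \<longleftrightarrow> (\<exists>t s'. exec c s t s' \<and> t \<le> T \<and> Q s')"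

section \<open>Variables and arrays left unchanged\<close>

primrec nvars_of :: "com \<Rightarrow> string set" where
  "nvars_of Skip = {}"
| "nvars_of (NAssign x e) = {x}"
| "nvars_of (NStore a d e) = {}"
| "nvars_of (FAssign x e) = {}"
| "nvars_of (FStore a d e) = {}"
| "nvars_of (Seq c1 c2) = nvars_of c1 \<union> nvars_of c2"
| "nvars_of (Cond b c1 c2) = nvars_of c1 \<union> nvars_of c2"
| "nvars_of (Loop b c) = nvars_of c"

primrec narrs_of :: "com \<Rightarrow> string set" where
  "narrs_of Skip = {}"
| "narrs_of (NAssign x e) = {}"
| "narrs_of (NStore a d e) = {a}"
| "narrs_of (FAssign x e) = {}"
| "narrs_of (FStore a d e) = {}"
| "narrs_of (Seq c1 c2) = narrs_of c1 \<union> narrs_of c2"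
| "narrs_of (Cond b c1 c2) = narrs_of c1 \<union> narrs_of c2"
| "narrs_of (Loop b c) = narrs_of c"

primrec fvars_of :: "com \<Rightarrow> string set" where
  "fvars_of Skip = {}"
| "fvars_of (NAssign x e) = {}"
| "fvars_of (NStore a d e) = {}"
| "fvars_of (FAssign x e) = {x}"
| "fvars_of (FStore a d e) = {}"
| "fvars_of (Seq c1 c2) = fvars_of c1 \<union> fvars_of c2"
| "fvars_of (Cond b c1 c2) = fvars_of c1 \<union> fvars_of c2"
| "fvars_of (Loop b c) = fvars_of c"

primrec farrs_of :: "com \<Rightarrow> string set" where
  "farrs_of Skip = {}"
| "farrs_of (NAssign x e) = {}"
| "farrs_of (NStore a d e) = {}"
| "farrs_of (FAssign x e) = {}"
| "farrs_of (FStore a d e) = {a}"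
| "farrs_of (Seq c1 c2) = farrs_of c1 \<union> farrs_of c2"
| "farrs_of (Cond b c1 c2) = farrs_of c1 \<union> farrs_of c2"
| "farrs_of (Loop b c) = farrs_of c"

text \<open>The proof rules supply this relation automatically, so loop invariants only have to
  describe what a body changes.\<close>

definition frame :: "com \<Rightarrow> 'a store \<Rightarrow> 'a store \<Rightarrow> bool" where
  "frame c s s' \<longleftrightarrow>
    (\<forall>x. x \<notin> nvars_of c \<longrightarrow> nvar s' x = nvar s x) \<and>
    (\<forall>a. a \<notin> narrs_of c \<longrightarrow> narr s' a = narr s a) \<and>
    (\<forall>x. x \<notin> fvars_of c \<longrightarrow> fvar s' x = fvar s x) \<and>
    (\<forall>a. a \<notin> farrs_of c \<longrightarrow> farr s' a = farr s a)"

lemma frame_refl: "frame c s s"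
  by (simp add: frame_def)

lemma exec_frame: "exec c s t s' \<Longrightarrow> frame c s s'"
  by (induction rule: exec.induct) (simp_all add: frame_def)

section \<open>Proof rules with time bounds\<close>

lemma runs_weaken:
  "runs c s T P \<Longrightarrow> T \<le> T' \<Longrightarrow> (\<And>s'. frame c s s' \<Longrightarrow> P s' \<Longrightarrow> Q s') \<Longrightarrow> runs c s T' Q"
  using exec_frame unfolding runs_def by (meson order_trans)

lemma runs_Skip: "1 \<le> T \<Longrightarrow> Q s \<Longrightarrow> runs Skip s T Q"
  unfolding runs_def by (intro exI conjI, rule exec.Skip)

lemma runs_NAssign:
  "1 + ncost e \<le> T \<Longrightarrow> Q (s\<lparr>nvar := (nvar s)(x := nval e s)\<rparr>) \<Longrightarrow> runs (NAssign x e) s T Q"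
  unfolding runs_def by (intro exI conjI, rule exec.NAssign)

lemma runs_NStore:
  "1 + ncost d + ncost e \<le> T \<Longrightarrow>
    Q (s\<lparr>narr := (narr s)(a := (narr s a)(nval d s := nval e s))\<rparr>) \<Longrightarrow>
    runs (NStore a d e) s T Q"
  unfolding runs_def by (intro exI conjI, rule exec.NStore)

lemma runs_FAssign:
  "1 + fcost e \<le> T \<Longrightarrow> Q (s\<lparr>fvar := (fvar s)(x := fval e s)\<rparr>) \<Longrightarrow> runs (FAssign x e) s T Q"
  unfolding runs_def by (intro exI conjI, rule exec.FAssign)

lemma runs_FStore:
  "1 + ncost d + fcost e \<le> T \<Longrightarrow>
    Q (s\<lparr>farr := (farr s)(a := (farr s a)(nval d s := fval e s))\<rparr>) \<Longrightarrow>
    runs (FStore a d e) s T Q"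
  unfolding runs_def by (intro exI conjI, rule exec.FStore)

lemma runs_Seq:
  assumes "runs c1 s T1 P" "\<And>s'. frame c1 s s' \<Longrightarrow> P s' \<Longrightarrow> runs c2 s' T2 Q" "T1 + T2 \<le> T"
  shows "runs (Seq c1 c2) s T Q"
proof -
  obtain t1 s1 where 1: "exec c1 s t1 s1" "t1 \<le> T1" "P s1"
    using assms(1) by (auto simp: runs_def)
  then obtain t2 s2 where 2: "exec c2 s1 t2 s2" "t2 \<le> T2" "Q s2"
    using assms(2)[OF exec_frame[OF 1(1)] 1(3)] unfolding runs_def by blast
  from exec.Seq[OF 1(1) 2(1)] have "exec (Seq c1 c2) s (t1 + t2) s2" .
  moreover have "t1 + t2 \<le> T" using 1(2) 2(2) assms(3) by linarith
  ultimately show ?thesis using 2(3) unfolding runs_def by blast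
qed

lemma runs_Cond:
  assumes "1 + bcost b \<le> T"
    and "bval b s \<Longrightarrow> runs c1 s (T - (1 + bcost b)) Q"
    and "\<not> bval b s \<Longrightarrow> runs c2 s (T - (1 + bcost b)) Q"
  shows "runs (Cond b c1 c2) s T Q"
proof (cases "bval b s")
  case True
  then obtain t s' where "exec c1 s t s'" "t \<le> T - (1 + bcost b)" "Q s'"
    using assms(2) by (auto simp: runs_def)
  moreover from this have "exec (Cond b c1 c2) s (1 + bcost b + t) s'"
    using True by (intro exec.CondTrue)
  moreover have "1 + bcost b + t \<le> T" using calculation(2) assms(1) by linarith
  ultimately show ?thesis unfolding runs_def by blast
next
  case False
  then obtain t s' where "exec c2 s t s'" "t \<le> T - (1 + bcost b)" "Q s'"
    using assms(3) by (auto simp: runs_def)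
  moreover from this have "exec (Cond b c1 c2) s (1 + bcost b + t) s'"
    using False by (intro exec.CondFalse)
  moreover have "1 + bcost b + t \<le> T" using calculation(2) assms(1) by linarith
  ultimately show ?thesis unfolding runs_def by blast
qed

lemma runs_LoopTrue:
  assumes "bval b s" "runs c s T1 P" "\<And>s'. P s' \<Longrightarrow> runs (Loop b c) s' T2 Q"
  shows "runs (Loop b c) s (1 + bcost b + T1 + T2) Q"
proof -
  obtain t1 s1 where 1: "exec c s t1 s1" "t1 \<le> T1" "P s1"
    using assms(2) by (auto simp: runs_def)
  then obtain t2 s2 where 2: "exec (Loop b c) s1 t2 s2" "t2 \<le> T2" "Q s2"
    using assms(3)[OF 1(3)] unfolding runs_def by blast
  from exec.LoopTrue[OF assms(1) 1(1) 2(1)]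
  have "exec (Loop b c) s (1 + bcost b + t1 + t2) s2" .
  moreover have "1 + bcost b + t1 + t2 \<le> 1 + bcost b + T1 + T2" using 1(2) 2(2) by linarith
  ultimately show ?thesis using 2(3) unfolding runs_def by blast
qed

lemma runs_LoopFalse: "\<not> bval b s \<Longrightarrow> Q s \<Longrightarrow> runs (Loop b c) s (1 + bcost b) Q"
  unfolding runs_def by (intro exI conjI, erule exec.LoopFalse) simp_all

definition for_loop :: "string \<Rightarrow> nexp \<Rightarrow> com \<Rightarrow> com" where
  "for_loop x b c = Seq (NAssign x (NLit 0))
    (Loop (NLess (NVar x) b) (Seq c (NAssign x (NAdd (NVar x) (NLit 1)))))"

lemma for_loop_frame_sets [simp]:
  "nvars_of (for_loop x b c) = insert x (nvars_of c)"
  "narrs_of (for_loop x b c) = narrs_of c"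
  "fvars_of (for_loop x b c) = fvars_of c"
  "farrs_of (for_loop x b c) = farrs_of c"
  by (auto simp: for_loop_def)

text \<open>Bounds of the form \<open>C * N ^ e\<close> are preserved by nesting: a loop adds 18 to
  the constant and 1 to the exponent. Here 18 is 2 for the initialization, 6 for the final test, and
  10 per pass for test and increment. The premise \<open>indep\<close> keeps the invariant valid
  when the counter changes.\<close>

lemma runs_for_loop:
  assumes step: "\<And>k s. frame (for_loop x b c) s0 s \<Longrightarrow> I k s \<Longrightarrow> nvar s x = k \<Longrightarrow> k < m \<Longrightarrow>
      runs c s (C * N ^ e) (I (Suc k))"
    and bound: "\<And>s. frame (for_loop x b c) s0 s \<Longrightarrow> nval b s = m"
    and indep: "\<And>k s v. I k s \<Longrightarrow> I k (s\<lparr>nvar := (nvar s)(x := v)\<rparr>)"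
    and init: "I 0 s0"
    and N: "m \<le> N" "1 \<le> N" and x: "x \<notin> nvars_of c" and b: "ncost b \<le> 3"
  shows "runs (for_loop x b c) s0 ((C + 18) * N ^ Suc e) (I m)"
proof -
  let ?F = "frame (for_loop x b c)" and ?T = "C * N ^ e"
  let ?L = "Loop (NLess (NVar x) b) (Seq c (NAssign x (NAdd (NVar x) (NLit 1))))"
  have upd: "?F s0 (s\<lparr>nvar := (nvar s)(x := v)\<rparr>)" if "?F s0 s" for s v
    using that by (simp add: frame_def)
  have frame_c: "?F s0 s'" if "?F s0 s" "frame c s s'" for s s'
    using that by (simp add: frame_def)
  have loop: "runs ?L s (6 + j * (?T + 10)) (I m)"
    if "?F s0 s" "I k s" "nvar s x = k" "k + j = m" for j k s
    using that
  proof (induction j arbitrary: k s)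
    case 0
    then have "\<not> bval (NLess (NVar x) b) s" using bound by simp
    from runs_LoopFalse[OF this] show ?case
      by (rule runs_weaken) (use 0 b in auto)
  next
    case (Suc j)
    let ?P = "\<lambda>s'. ?F s0 s' \<and> I (Suc k) s' \<and> nvar s' x = Suc k"
    have "runs (Seq c (NAssign x (NAdd (NVar x) (NLit 1)))) s (?T + 4) ?P"
    proof (rule runs_Seq)
      show "runs c s ?T (I (Suc k))"
        using step Suc.prems by simp
      fix s' assume s': "frame c s s'" "I (Suc k) s'"
      then have "nvar s' x = k" using x Suc.prems(3) by (simp add: frame_def)
      then show "runs (NAssign x (NAdd (NVar x) (NLit 1))) s' 4 ?P"
        using upd[OF frame_c[OF Suc.prems(1) s'(1)]] indep[OF s'(2)]
        by (intro runs_NAssign) simp_all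
    qed simp
    then have "runs ?L s (1 + bcost (NLess (NVar x) b) + (?T + 4) + (6 + j * (?T + 10))) (I m)"
    proof (rule runs_LoopTrue[rotated])
      show "bval (NLess (NVar x) b) s" using bound Suc.prems by simp
      show "runs ?L s' (6 + j * (?T + 10)) (I m)" if "?P s'" for s'
        using Suc.IH[of s' "Suc k"] that Suc.prems(4) by simp
    qed
    then show ?case
      by (rule runs_weaken) (use b in auto)
  qed
  have "runs (for_loop x b c) s0 (2 + (6 + m * (?T + 10))) (I m)"
    unfolding for_loop_def
  proof (rule runs_Seq)
    show "runs (NAssign x (NLit 0)) s0 2 (\<lambda>s. ?F s0 s \<and> I 0 s \<and> nvar s x = 0)"
      using upd[OF frame_refl] indep[OF init] by (intro runs_NAssign) simp_all
    show "runs ?L s' (6 + m * (?T + 10)) (I m)" if "?F s0 s' \<and> I 0 s' \<and> nvar s' x = 0" for s'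
      using loop[of s' 0 m] that by simp
  qed simp
  then show ?thesis
  proof (rule runs_weaken)
    have "m * (?T + 10) \<le> N * (?T + 10)" using N(1) by (rule mult_right_mono) simp
    moreover have "N \<le> N ^ Suc e" using N(2) by simp
    moreover have "1 \<le> N ^ Suc e" using N(2) by simp
    moreover have "N * (?T + 10) = C * N ^ Suc e + 10 * N" by (simp add: algebra_simps)
    moreover have "(C + 18) * N ^ Suc e = C * N ^ Suc e + 18 * N ^ Suc e"
      by (rule add_mult_distrib)
    ultimately show "2 + (6 + m * (?T + 10)) \<le> (C + 18) * N ^ Suc e" by linarith
  qed
qed

section \<open>The program\<close>

abbreviation gate_field :: "string \<Rightarrow> nexp" where
  "gate_field a \<equiv> NArr a (NVar ''i'')"

text \<open>The matrix lies in one flat array in row-major order. Row offsets come from a table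
  because the machine has no multiplication of naturals.\<close>

abbreviation entry :: "string \<Rightarrow> nexp \<Rightarrow> fexp" where
  "entry p e \<equiv> FArr ''B'' (NAdd (NArr ''row'' (NVar p)) e)"

definition gate_case :: "string \<Rightarrow> com \<Rightarrow> com \<Rightarrow> com \<Rightarrow> com" where
  "gate_case A v c m =
    Cond (NEq (gate_field ''kind'') (NLit 0)) v
   (Cond (NEq (gate_field ''kind'') (NLit 1)) c
   (Cond (NEq (gate_field ''kind'') (NLit 2))
      (FStore A (NVar ''i'')
        (FAdd (FArr A (gate_field ''fst'')) (FArr A (gate_field ''snd''))))
      m))"

definition sweeps :: "com \<Rightarrow> com" where
  "sweeps c = for_loop ''t'' (NVar ''size'') (for_loop ''i'' (NVar ''size'') c)"

definition const_step :: com where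
  "const_step = gate_case ''c''
    (FStore ''c'' (NVar ''i'') FZero)
    (FStore ''c'' (NVar ''i'') (FArr ''const'' (NVar ''i'')))
    (FStore ''c'' (NVar ''i'')
      (FMul (FArr ''c'' (gate_field ''fst'')) (FArr ''c'' (gate_field ''snd''))))"

abbreviation linear_exp :: fexp where
  "linear_exp \<equiv> FAdd
    (FMul (FArr ''c'' (gate_field ''fst'')) (FArr ''w'' (gate_field ''snd'')))
    (FMul (FArr ''c'' (gate_field ''snd'')) (FArr ''w'' (gate_field ''fst'')))"

definition leaf_step :: com where
  "leaf_step = gate_case ''w''
    (Cond (NEq (gate_field ''fst'') (NVar ''x''))
      (FStore ''w'' (NVar ''i'') FOne) (FStore ''w'' (NVar ''i'') FZero))
    (FStore ''w'' (NVar ''i'') FZero)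
    (FStore ''w'' (NVar ''i'') linear_exp)"

definition pair_step :: com where
  "pair_step = gate_case ''w''
    (FStore ''w'' (NVar ''i'') FZero)
    (FStore ''w'' (NVar ''i'') FZero)
    (Cond (NEq (NVar ''p'') (NVar ''q''))
      (FStore ''w'' (NVar ''i'') (FAdd linear_exp
        (FMul (entry ''p'' (gate_field ''fst'')) (entry ''p'' (gate_field ''snd'')))))
      (FStore ''w'' (NVar ''i'') (FAdd linear_exp (FAdd
        (FMul (entry ''p'' (gate_field ''fst'')) (entry ''q'' (gate_field ''snd'')))
        (FMul (entry ''p'' (gate_field ''snd'')) (entry ''q'' (gate_field ''fst'')))))))"

definition copy_row :: com where
  "copy_row = for_loop ''i'' (NVar ''size'')
    (FStore ''B'' (NAdd (NArr ''row'' (NVar ''l'')) (NVar ''i'')) (FArr ''w'' (NVar ''i'')))"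

definition subtract_row :: com where
  "subtract_row = for_loop ''i'' (NVar ''size'')
    (FStore ''w'' (NVar ''i'')
      (FSub (FArr ''w'' (NVar ''i'')) (FMul (FVar ''f'') (entry ''l'' (NVar ''i'')))))"

text \<open>The program counterpart of \<open>reduce\<close>. The factor is saved in
  \<open>''f''\<close> because \<open>subtract_row\<close> overwrites entry \<open>l\<close> of
  \<open>''w''\<close> while later columns still use it.\<close>

definition insert_w :: com where
  "insert_w = for_loop ''l'' (NVar ''size'')
    (Seq (Cond (BAnd (BNot (FIsZero (FArr ''w'' (NVar ''l''))))
                     (FIsZero (entry ''l'' (NVar ''l''))))
            copy_row Skip)
    (Seq (FAssign ''f'' (FDiv (FArr ''w'' (NVar ''l'')) (entry ''l'' (NVar ''l''))))
       subtract_row))"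

text \<open>Multiples of the size by repeated addition, starting from cell 0 of the initially zero
  array.\<close>

definition compute_rows :: com where
  "compute_rows = for_loop ''p'' (NVar ''size'')
    (NStore ''row'' (NAdd (NVar ''p'') (NLit 1)) (NAdd (NArr ''row'' (NVar ''p'')) (NVar ''size'')))"

definition insert_leaves :: com where
  "insert_leaves = for_loop ''x'' (NVar ''n'') (Seq (sweeps leaf_step) insert_w)"

text \<open>At most \<open>size\<close> rounds can gain a pivot, so one of \<open>size + 1\<close>
  rounds gains none.\<close>

definition saturate :: com where
  "saturate = for_loop ''r'' (NAdd (NVar ''size'') (NLit 1))
    (for_loop ''p'' (NVar ''size'') (for_loop ''q'' (NVar ''size'')
      (Seq (sweeps pair_step) insert_w)))"

definition check_output :: com where
  "check_output = Seq
    (Cond (FIsZero (FArr ''c'' (NVar ''out'')))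
      (NAssign ''result'' (NLit 1)) (NAssign ''result'' (NLit 0)))
    (for_loop ''p'' (NVar ''size'')
      (Cond (FIsZero (entry ''p'' (NVar ''out''))) Skip (NAssign ''result'' (NLit 0))))"

definition identity_test :: com where
  "identity_test =
    Seq compute_rows (Seq (sweeps const_step) (Seq insert_leaves (Seq saturate check_output)))"

lemmas step_defs = gate_case_def const_step_def leaf_step_def pair_step_def

lemma frame_sets [simp]:
  "nvars_of const_step = {}" "narrs_of const_step = {}"
  "fvars_of const_step = {}" "farrs_of const_step = {''c''}"
  "nvars_of leaf_step = {}" "narrs_of leaf_step = {}"
  "fvars_of leaf_step = {}" "farrs_of leaf_step = {''w''}"
  "nvars_of pair_step = {}" "narrs_of pair_step = {}"
  "fvars_of pair_step = {}" "farrs_of pair_step = {''w''}"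
  "nvars_of (sweeps c) = {''t'', ''i''} \<union> nvars_of c" "narrs_of (sweeps c) = narrs_of c"
  "fvars_of (sweeps c) = fvars_of c" "farrs_of (sweeps c) = farrs_of c"
  "nvars_of copy_row = {''i''}" "narrs_of copy_row = {}"
  "fvars_of copy_row = {}" "farrs_of copy_row = {''B''}"
  "nvars_of subtract_row = {''i''}" "narrs_of subtract_row = {}"
  "fvars_of subtract_row = {}" "farrs_of subtract_row = {''w''}"
  "nvars_of insert_w = {''l'', ''i''}" "narrs_of insert_w = {}"
  "fvars_of insert_w = {''f''}" "farrs_of insert_w = {''B'', ''w''}"
  "nvars_of compute_rows = {''p''}" "narrs_of compute_rows = {''row''}"
  "fvars_of compute_rows = {}" "farrs_of compute_rows = {}"
  "nvars_of insert_leaves = {''x'', ''t'', ''i'', ''l''}" "narrs_of insert_leaves = {}"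
  "fvars_of insert_leaves = {''f''}" "farrs_of insert_leaves = {''w'', ''B''}"
  "nvars_of saturate = {''r'', ''p'', ''q'', ''t'', ''i'', ''l''}" "narrs_of saturate = {}"
  "fvars_of saturate = {''f''}" "farrs_of saturate = {''w'', ''B''}"
  by (auto simp: step_defs sweeps_def copy_row_def subtract_row_def insert_w_def
      compute_rows_def insert_leaves_def saturate_def)

lemma row_index_eq:
  fixes m :: nat
  assumes "i < m" "j < m"
  shows "p * m + i = q * m + j \<longleftrightarrow> p = q \<and> i = j"
proof
  assume eq: "p * m + i = q * m + j"
  have "(p * m + i) div m = p" "(q * m + j) div m = q" using assms by auto
  with eq show "p = q \<and> i = j" by auto
qed simp

context valid_circuit
begin

section \<open>Stores as vectors and matrices\<close>

definition input_intact :: "'a store \<Rightarrow> bool" where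
  "input_intact s \<longleftrightarrow> nvar s ''n'' = n \<and> nvar s ''size'' = S \<and> nvar s ''out'' = out \<Psi> \<and>
    narr s ''kind'' = per_gate gate_kind \<Psi> \<and> narr s ''fst'' = per_gate gate_fst \<Psi> \<and>
    narr s ''snd'' = per_gate gate_snd \<Psi> \<and> farr s ''const'' = per_gate gate_const \<Psi>"

definition rows_ready :: "'a store \<Rightarrow> bool" where
  "rows_ready s \<longleftrightarrow> (\<forall>p<S. narr s ''row'' p = p * S)"

definition consts_ready :: "'a store \<Rightarrow> bool" where
  "consts_ready s \<longleftrightarrow> (\<forall>i<S. farr s ''c'' i = const_coef i)"

definition ready :: "'a store \<Rightarrow> bool" where
  "ready s \<longleftrightarrow> input_intact s \<and> rows_ready s \<and> consts_ready s"

text \<open>Cells from \<open>S\<close> on read as zero, in \<open>matrix\<close> too, so the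
  abstract objects are equal as functions to those of the algebraic part.\<close>

definition vec :: "string \<Rightarrow> 'a store \<Rightarrow> nat \<Rightarrow> 'a" where
  "vec A s i = (if i < S then farr s A i else 0)"

definition matrix :: "'a store \<Rightarrow> nat \<Rightarrow> nat \<Rightarrow> 'a" where
  "matrix s p i = (if p < S \<and> i < S then farr s ''B'' (p * S + i) else 0)"

lemma input_intact_frame:
  assumes "frame c s s'" "input_intact s"
    and "''n'' \<notin> nvars_of c" "''size'' \<notin> nvars_of c" "''out'' \<notin> nvars_of c"
    and "''kind'' \<notin> narrs_of c" "''fst'' \<notin> narrs_of c" "''snd'' \<notin> narrs_of c"
    and "''const'' \<notin> farrs_of c"
  shows "input_intact s'"
  using assms by (simp add: input_intact_def frame_def)

lemma ready_frame:
  assumes "frame c s s'" "ready s"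
    and "''n'' \<notin> nvars_of c" "''size'' \<notin> nvars_of c" "''out'' \<notin> nvars_of c"
    and "''kind'' \<notin> narrs_of c" "''fst'' \<notin> narrs_of c" "''snd'' \<notin> narrs_of c"
    and "''row'' \<notin> narrs_of c" "''const'' \<notin> farrs_of c" "''c'' \<notin> farrs_of c"
  shows "ready s'"
  using assms by (simp add: ready_def rows_ready_def consts_ready_def input_intact_def frame_def)

lemma matrix_frame: "frame c s s' \<Longrightarrow> ''B'' \<notin> farrs_of c \<Longrightarrow> matrix s' = matrix s"
  by (simp add: matrix_def frame_def fun_eq_iff)

text \<open>
  The gates need not be listed in topological order. After \<open>t\<close> sweeps over the whole list the
  values of all gates of rank less than \<open>t\<close> are correct, whatever the initial values were.
\<close>

lemma runs_sweeps:
  fixes F :: "nat \<Rightarrow> 'a"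
  assumes step: "\<And>i s. frame (sweeps c) s0 s \<Longrightarrow> nvar s ''i'' = i \<Longrightarrow> i < S \<Longrightarrow>
      runs c s C (\<lambda>s'. \<exists>v. farr s' A = (farr s A)(i := v) \<and>
        ((\<forall>j\<in>children (gates \<Psi> ! i). farr s A j = F j) \<longrightarrow> v = F i))"
    and size: "nvar s0 ''size'' = S" and N: "S \<le> N"
    and vars: "nvars_of c \<inter> {''t'', ''i'', ''size''} = {}"
  shows "runs (sweeps c) s0 ((C + 36) * N\<^sup>2) (\<lambda>s. \<forall>i<S. farr s A i = F i)"
proof -
  have N1: "1 \<le> N" using N out_less by linarith
  define I where "I t s \<longleftrightarrow> (\<forall>j<S. rank j < t \<longrightarrow> farr s A j = F j)"
    for t and s :: "'a store"
  have "runs (sweeps c) s0 ((C + 18 + 18) * N ^ Suc 1) (I S)"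
    unfolding sweeps_def
  proof (rule runs_for_loop)
    fix t s1
    assume f1: "frame (for_loop ''t'' (NVar ''size'') (for_loop ''i'' (NVar ''size'') c)) s0 s1"
      and I: "I t s1"
    \<comment> \<open>Inside sweep \<open>t\<close>, lower ranks are already correct and rank
      \<open>t\<close> is correct at the positions visited so far.\<close>
    define J where "J k s \<longleftrightarrow> (\<forall>j<S. rank j < t \<or> j < k \<and> rank j \<le> t \<longrightarrow> farr s A j = F j)"
      for k and s :: "'a store"
    have "runs (for_loop ''i'' (NVar ''size'') c) s1 ((C + 18) * N ^ Suc 0) (J S)"
    proof (rule runs_for_loop)
      fix k s
      assume f: "frame (for_loop ''i'' (NVar ''size'') c) s1 s" and J: "J k s"
        and k: "nvar s ''i'' = k" "k < S"
      have "frame (sweeps c) s0 s"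
        using f f1 by (simp add: frame_def sweeps_def)
      from step[OF this k] have "runs c s C (J (Suc k))"
      proof (rule runs_weaken)
        fix s' :: "'a store"
        assume "\<exists>v. farr s' A = (farr s A)(k := v) \<and>
          ((\<forall>j\<in>children (gates \<Psi> ! k). farr s A j = F j) \<longrightarrow> v = F k)"
        then obtain v where v: "farr s' A = (farr s A)(k := v)"
          "(\<forall>j\<in>children (gates \<Psi> ! k). farr s A j = F j) \<Longrightarrow> v = F k" by blast
        \<comment> \<open>The children of \<open>k\<close> have rank below \<open>t\<close>. The
          same argument shows that recomputing a gate that is already correct does not spoil
          it.\<close>
        have "v = F k" if "rank k \<le> t"
        proof (rule v(2), rule ballI)
          fix j assume j: "j \<in> children (gates \<Psi> ! k)"
          then have "rank j < t" "j < S"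
            using rank_child[OF k(2)] children_less[OF k(2)] that by fastforce+
          then show "farr s A j = F j" using J by (simp add: J_def)
        qed
        then show "J (Suc k) s'"
          using J by (auto simp: J_def v(1) less_Suc_eq)
      qed simp
      then show "runs c s (C * N ^ 0) (J (Suc k))" by simp
    qed (use f1 vars size I N N1 in \<open>auto simp: J_def I_def frame_def\<close>)
    then show "runs (for_loop ''i'' (NVar ''size'') c) s1 ((C + 18) * N ^ 1) (I (Suc t))"
      by (rule runs_weaken) (auto simp: J_def I_def)
  qed (use vars size N N1 in \<open>auto simp: I_def frame_def\<close>)
  \<comment> \<open>Every rank is below \<open>S\<close>, so \<open>S\<close> sweeps settle all
    gates.\<close>
  then show ?thesis
    by (rule runs_weaken) (auto simp: I_def rank_less power2_eq_square)
qed

lemma const_coef_Prod: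
  assumes "i < S" "gates \<Psi> ! i = Prod j k"
  shows "const_coef i = const_coef j * const_coef k"
  using assms(1) Prod_less[OF assms] gate_poly_Prod[OF assms]
  by (simp add: coef_def lookup_np_mult_MOne)

lemma runs_consts:
  assumes "input_intact s0" "S \<le> N"
  shows "runs (sweeps const_step) s0 (76 * N\<^sup>2) consts_ready"
proof -
  \<comment> \<open>A generous 40 steps per gate, plus 18 for each of the two nested loops; 60 and
    100 play the same role for leaves and pairs.\<close>
  have "runs (sweeps const_step) s0 ((40 + 36) * N\<^sup>2) (\<lambda>s. \<forall>i<S. farr s ''c'' i = const_coef i)"
  proof (rule runs_sweeps)
    fix i s
    assume "frame (sweeps const_step) s0 s" and i: "nvar s ''i'' = i" "i < S"
    then have s: "input_intact s"
      by (rule_tac input_intact_frame) (use assms in auto)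
    show "runs const_step s 40 (\<lambda>s'. \<exists>v. farr s' ''c'' = (farr s ''c'')(i := v) \<and>
        ((\<forall>j\<in>children (gates \<Psi> ! i). farr s ''c'' j = const_coef j) \<longrightarrow> v = const_coef i))"
      using s i coef_Var[OF i(2)] coef_Const[OF i(2)] coef_Sum[OF i(2)] const_coef_Prod[OF i(2)]
      unfolding step_defs
      by (cases "gates \<Psi> ! i"; intro runs_Cond runs_FStore)
        (auto simp: input_intact_def per_gate_def)
  qed (use assms in \<open>auto simp: input_intact_def\<close>)
  then show ?thesis
    by (rule runs_weaken) (auto simp: consts_ready_def)
qed

lemma runs_leaf:
  assumes "ready s0" "nvar s0 ''x'' = x" "S \<le> N"
  shows "runs (sweeps leaf_step) s0 (96 * N\<^sup>2) (\<lambda>s. vec ''w'' s = tree_vec (Leaf x))"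
proof -
  let ?F = "solution (leaf_source x)"
  have "runs (sweeps leaf_step) s0 ((60 + 36) * N\<^sup>2) (\<lambda>s. \<forall>i<S. farr s ''w'' i = ?F i)"
  proof (rule runs_sweeps)
    fix i s
    assume f: "frame (sweeps leaf_step) s0 s" and i: "nvar s ''i'' = i" "i < S"
    have s: "ready s"
      by (rule ready_frame[OF f]) (use assms in auto)
    have x: "nvar s ''x'' = x"
      using f assms(2) by (simp add: frame_def)
    note F = solution_eq[OF i(2), of "leaf_source x"]
    show "runs leaf_step s 60 (\<lambda>s'. \<exists>v. farr s' ''w'' = (farr s ''w'')(i := v) \<and>
        ((\<forall>j\<in>children (gates \<Psi> ! i). farr s ''w'' j = ?F j) \<longrightarrow> v = ?F i))"
      using s i x Sum_less[OF i(2)] Prod_less[OF i(2)] F unfolding step_defs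
      by (cases "gates \<Psi> ! i"; intro runs_Cond runs_FStore)
        (auto simp: ready_def input_intact_def consts_ready_def per_gate_def linear_part_def leaf_source_def)
  qed (use assms in \<open>auto simp: ready_def input_intact_def\<close>)
  then show ?thesis
    by (rule runs_weaken) (auto simp: vec_def fun_eq_iff tree_vec_Leaf solution_ge)
qed

lemma runs_pair:
  assumes "ready s0" "nvar s0 ''p'' = p" "nvar s0 ''q'' = q" "p < S" "q < S" "S \<le> N"
  shows "runs (sweeps pair_step) s0 (136 * N\<^sup>2) (\<lambda>s. vec ''w'' s = pair_vec (matrix s0) p q)"
proof -
  let ?src = "if p = q then square_source (matrix s0 p)
    else cross_source (matrix s0 p) (matrix s0 q)"
  let ?F = "solution ?src"
  have "runs (sweeps pair_step) s0 ((100 + 36) * N\<^sup>2) (\<lambda>s. \<forall>i<S. farr s ''w'' i = ?F i)"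
  proof (rule runs_sweeps)
    fix i s
    assume f: "frame (sweeps pair_step) s0 s" and i: "nvar s ''i'' = i" "i < S"
    have s: "ready s"
      by (rule ready_frame[OF f]) (use assms in auto)
    have pq: "nvar s ''p'' = p" "nvar s ''q'' = q" "farr s ''B'' = farr s0 ''B''"
      using f assms(2,3) by (simp_all add: frame_def)
    note F = solution_eq[OF i(2), of ?src]
    show "runs pair_step s 100 (\<lambda>s'. \<exists>v. farr s' ''w'' = (farr s ''w'')(i := v) \<and>
        ((\<forall>j\<in>children (gates \<Psi> ! i). farr s ''w'' j = ?F j) \<longrightarrow> v = ?F i))"
      using s i pq assms(4,5) Sum_less[OF i(2)] Prod_less[OF i(2)] F unfolding step_defs
      by (cases "gates \<Psi> ! i"; intro runs_Cond runs_FStore)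
        (auto simp: ready_def input_intact_def consts_ready_def rows_ready_def per_gate_def
          linear_part_def square_source_def cross_source_def matrix_def)
  qed (use assms in \<open>auto simp: ready_def input_intact_def\<close>)
  then show ?thesis
    by (rule runs_weaken)
      (auto simp: vec_def fun_eq_iff pair_vec_def square_def cross_def solution_ge)
qed


section \<open>Elimination on the store\<close>

lemma vec_update [simp]:
  "vec A (s\<lparr>nvar := g\<rparr>) = vec A s" "vec A (s\<lparr>fvar := h\<rparr>) = vec A s"
  by (simp_all add: vec_def fun_eq_iff)

lemma matrix_update [simp]:
  "matrix (s\<lparr>nvar := g\<rparr>) = matrix s" "matrix (s\<lparr>fvar := h\<rparr>) = matrix s"
  by (simp_all add: matrix_def fun_eq_iff)

lemma vec_frame: "frame c s s' \<Longrightarrow> A \<notin> farrs_of c \<Longrightarrow> vec A s' = vec A s"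
  by (simp add: vec_def frame_def fun_eq_iff)

lemma vec_store:
  "k < S \<Longrightarrow> vec A (s\<lparr>farr := (farr s)(A := (farr s A)(k := v))\<rparr>) = (vec A s)(k := v)"
  by (auto simp: vec_def fun_eq_iff)

lemma matrix_store:
  "l < S \<Longrightarrow> k < S \<Longrightarrow> matrix (s\<lparr>farr := (farr s)(''B'' := (farr s ''B'')(l * S + k := v))\<rparr>) =
    (matrix s)(l := (matrix s l)(k := v))"
  by (auto simp: matrix_def fun_eq_iff row_index_eq)

lemma nval_size: "ready s \<Longrightarrow> nval (NVar ''size'') s = S"
  by (simp add: ready_def input_intact_def)

lemma fval_entry:
  "ready s \<Longrightarrow> nvar s p = l \<Longrightarrow> l < S \<Longrightarrow> nval e s = k \<Longrightarrow> k < S \<Longrightarrow>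
    fval (entry p e) s = matrix s l k"
  by (simp add: ready_def rows_ready_def matrix_def)

lemma runs_copy_row:
  assumes s0: "ready s0" and l: "nvar s0 ''l'' = l" "l < S" and N: "S \<le> N"
  shows "runs copy_row s0 (28 * N) (\<lambda>s. matrix s = (matrix s0)(l := vec ''w'' s0))"
proof -
  define I where "I k s \<longleftrightarrow>
      matrix s = (matrix s0)(l := \<lambda>i. if i < k then vec ''w'' s0 i else matrix s0 l i)"
    for k and s :: "'a store"
  have "runs copy_row s0 ((10 + 18) * N ^ Suc 0) (I S)"
    unfolding copy_row_def
  proof (rule runs_for_loop)
    fix k s
    assume f: "frame (for_loop ''i'' (NVar ''size'') (FStore ''B''
          (NAdd (NArr ''row'' (NVar ''l'')) (NVar ''i'')) (FArr ''w'' (NVar ''i'')))) s0 s"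
      and I: "I k s" and k: "nvar s ''i'' = k" "k < S"
    have r: "ready s" by (rule ready_frame[OF f s0]) auto
    have w: "vec ''w'' s0 = vec ''w'' s" by (rule vec_frame[OF f, symmetric]) simp
    have "nvar s ''l'' = l" using f l by (simp add: frame_def)
    then have "nval (NAdd (NArr ''row'' (NVar ''l'')) (NVar ''i'')) s = l * S + k"
      using r k l by (simp add: ready_def rows_ready_def)
    moreover have "fval (FArr ''w'' (NVar ''i'')) s = vec ''w'' s0 k"
      using k by (simp add: w) (simp add: vec_def)
    ultimately show "runs (FStore ''B'' (NAdd (NArr ''row'' (NVar ''l'')) (NVar ''i''))
        (FArr ''w'' (NVar ''i''))) s (10 * N ^ 0) (I (Suc k))"
      using I k l by (intro runs_FStore)
        (auto simp: I_def matrix_store fun_eq_iff less_Suc_eq simp del: nval.simps fval.simps)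
  next
    fix s
    assume f: "frame (for_loop ''i'' (NVar ''size'') (FStore ''B''
          (NAdd (NArr ''row'' (NVar ''l'')) (NVar ''i'')) (FArr ''w'' (NVar ''i'')))) s0 s"
    show "nval (NVar ''size'') s = S"
      by (rule nval_size, rule ready_frame[OF f s0]) auto
  qed (use N out_less in \<open>auto simp: I_def\<close>)
  then show ?thesis
    by (rule runs_weaken) (auto simp: I_def fun_eq_iff vec_def matrix_def)
qed

lemma runs_subtract_row:
  assumes s0: "ready s0" and l: "nvar s0 ''l'' = l" "l < S" and N: "S \<le> N"
  shows "runs subtract_row s0 (38 * N)
    (\<lambda>s. vec ''w'' s = (\<lambda>i. vec ''w'' s0 i - fvar s0 ''f'' * matrix s0 l i))"
proof -
  define I where "I k s \<longleftrightarrow> vec ''w'' s =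
      (\<lambda>i. if i < k then vec ''w'' s0 i - fvar s0 ''f'' * matrix s0 l i else vec ''w'' s0 i)"
    for k and s :: "'a store"
  let ?c = "FStore ''w'' (NVar ''i'')
    (FSub (FArr ''w'' (NVar ''i'')) (FMul (FVar ''f'') (entry ''l'' (NVar ''i''))))"
  have "runs subtract_row s0 ((20 + 18) * N ^ Suc 0) (I S)"
    unfolding subtract_row_def
  proof (rule runs_for_loop)
    fix k s
    assume f: "frame (for_loop ''i'' (NVar ''size'') ?c) s0 s"
      and I: "I k s" and k: "nvar s ''i'' = k" "k < S"
    have r: "ready s" by (rule ready_frame[OF f s0]) auto
    have B: "matrix s = matrix s0" by (rule matrix_frame[OF f]) simp
    have lf: "nvar s ''l'' = l" "fvar s ''f'' = fvar s0 ''f''"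
      using f l by (simp_all add: frame_def)
    have "fval (entry ''l'' (NVar ''i'')) s = matrix s0 l k"
      using fval_entry[OF r lf(1) l(2), of "NVar ''i''" k] k by (simp add: B)
    moreover have "fval (FArr ''w'' (NVar ''i'')) s = vec ''w'' s k"
      using k by (simp add: vec_def)
    ultimately have "fval (FSub (FArr ''w'' (NVar ''i''))
        (FMul (FVar ''f'') (entry ''l'' (NVar ''i'')))) s =
        vec ''w'' s0 k - fvar s0 ''f'' * matrix s0 l k"
      using I lf by (simp add: I_def)
    then show "runs ?c s (20 * N ^ 0) (I (Suc k))"
      using I k by (intro runs_FStore)
        (auto simp: I_def vec_store fun_eq_iff less_Suc_eq simp del: fval.simps)
  next
    fix s
    assume f: "frame (for_loop ''i'' (NVar ''size'') ?c) s0 s"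
    show "nval (NVar ''size'') s = S"
      by (rule nval_size, rule ready_frame[OF f s0]) auto
  qed (use N out_less in \<open>auto simp: I_def\<close>)
  then show ?thesis
    by (rule runs_weaken) (auto simp: I_def fun_eq_iff vec_def matrix_def)
qed

lemma runs_insert_w:
  assumes s0: "ready s0" and N: "S \<le> N"
  shows "runs insert_w s0 (138 * N\<^sup>2)
    (\<lambda>s. matrix s = insert_vec S (matrix s0) (vec ''w'' s0))"
proof -
  have N1: "1 \<le> N" using N out_less by linarith
  \<comment> \<open>The store mirrors the function \<open>reduce\<close> column by column, so
    correctness of the loop is inherited from \<open>insert_vec\<close>.\<close>
  define I where "I l s \<longleftrightarrow> (matrix s, vec ''w'' s) = reduce l (matrix s0, vec ''w'' s0)"
    for l and s :: "'a store"
  let ?cond = "Cond (BAnd (BNot (FIsZero (FArr ''w'' (NVar ''l''))))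
      (FIsZero (entry ''l'' (NVar ''l'')))) copy_row Skip"
  let ?factor = "FAssign ''f'' (FDiv (FArr ''w'' (NVar ''l'')) (entry ''l'' (NVar ''l'')))"
  let ?c = "Seq ?cond (Seq ?factor subtract_row)"
  have "runs insert_w s0 ((120 + 18) * N ^ Suc 1) (I S)"
    unfolding insert_w_def
  proof (rule runs_for_loop)
    fix l s
    assume f: "frame (for_loop ''l'' (NVar ''size'') ?c) s0 s"
      and I: "I l s" and l: "nvar s ''l'' = l" "l < S"
    have r: "ready s" by (rule ready_frame[OF f s0]) auto
    let ?B = "add_row l (matrix s) (vec ''w'' s)"
    have "runs ?c s (120 * N) (I (Suc l))"
    proof (rule runs_Seq)
      show "runs ?cond s (30 + 28 * N) (\<lambda>s'. matrix s' = ?B \<and> vec ''w'' s' = vec ''w'' s)"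
      proof (rule runs_Cond)
        assume b: "bval (BAnd (BNot (FIsZero (FArr ''w'' (NVar ''l''))))
          (FIsZero (entry ''l'' (NVar ''l'')))) s"
        show "runs copy_row s (30 + 28 * N - (1 + bcost (BAnd (BNot (FIsZero (FArr ''w'' (NVar ''l''))))
          (FIsZero (entry ''l'' (NVar ''l''))))))
          (\<lambda>s'. matrix s' = ?B \<and> vec ''w'' s' = vec ''w'' s)"
          by (rule runs_weaken[OF runs_copy_row[OF r l N]])
            (use b fval_entry[OF r l, of "NVar ''l''" l] l in
              \<open>auto simp: add_row_def vec_def vec_frame\<close>)
      next
        assume b: "\<not> bval (BAnd (BNot (FIsZero (FArr ''w'' (NVar ''l''))))
          (FIsZero (entry ''l'' (NVar ''l'')))) s"
        then show "runs Skip s (30 + 28 * N - (1 + bcost (BAnd (BNot (FIsZero (FArr ''w'' (NVar ''l''))))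
          (FIsZero (entry ''l'' (NVar ''l''))))))
          (\<lambda>s'. matrix s' = ?B \<and> vec ''w'' s' = vec ''w'' s)"
          using fval_entry[OF r l, of "NVar ''l''" l] l
          by (intro runs_Skip) (auto simp: add_row_def vec_def)
      qed simp
    next
      fix s1
      assume f1: "frame ?cond s s1" and s1: "matrix s1 = ?B \<and> vec ''w'' s1 = vec ''w'' s"
      have r1: "ready s1" by (rule ready_frame[OF f1 r]) auto
      have l1: "nvar s1 ''l'' = l" using f1 l by (simp add: frame_def)
      show "runs (Seq ?factor subtract_row) s1 (15 + 38 * N) (I (Suc l))"
      proof (rule runs_Seq)
        show "runs ?factor s1 15 (\<lambda>s'. matrix s' = ?B \<and> vec ''w'' s' = vec ''w'' s \<and>
            fvar s' ''f'' = vec ''w'' s l / ?B l l)"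
          using fval_entry[OF r1 l1 l(2), of "NVar ''l''" l] l1 l(2) s1
          by (intro runs_FAssign) (auto simp: vec_def fun_eq_iff split: if_splits)
      next
        fix s2
        assume f2: "frame ?factor s1 s2" and s2: "matrix s2 = ?B \<and> vec ''w'' s2 = vec ''w'' s \<and>
            fvar s2 ''f'' = vec ''w'' s l / ?B l l"
        have r2: "ready s2" by (rule ready_frame[OF f2 r1]) auto
        have l2: "nvar s2 ''l'' = l" using f2 l1 by (simp add: frame_def)
        show "runs subtract_row s2 (38 * N) (I (Suc l))"
        proof (rule runs_weaken[OF runs_subtract_row[OF r2 l2 l(2) N]])
          fix s3
          assume f3: "frame subtract_row s2 s3"
            and s3: "vec ''w'' s3 = (\<lambda>i. vec ''w'' s2 i - fvar s2 ''f'' * matrix s2 l i)"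
          have "matrix s3 = ?B" using matrix_frame[OF f3] s2 by simp
          moreover have "vec ''w'' s3 = clear (?B l) l (vec ''w'' s)"
            using s2 by (simp add: s3 clear_def fun_eq_iff)
          ultimately show "I (Suc l) s3"
            using I[unfolded I_def, symmetric] by (simp add: I_def Let_def)
        qed simp
      qed simp
    next
      show "30 + 28 * N + (15 + 38 * N) \<le> 120 * N" using N1 by simp
    qed
    then show "runs ?c s (120 * N ^ 1) (I (Suc l))" by simp
  next
    fix s
    assume f: "frame (for_loop ''l'' (NVar ''size'') ?c) s0 s"
    show "nval (NVar ''size'') s = S"
      by (rule nval_size, rule ready_frame[OF f s0]) auto
  qed (use N N1 in \<open>auto simp: I_def\<close>)
  then show ?thesis
    by (rule runs_weaken) (auto simp: I_def insert_vec_def power2_eq_square dest: arg_cong[of _ _ fst])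
qed

section \<open>The phases and the total running time\<close>

lemma runs_insert_leaves:
  assumes s0: "ready s0" and B: "matrix s0 = (\<lambda>_ _. 0)" and N: "S \<le> N" "n \<le> N"
  shows "runs insert_leaves s0 (252 * N ^ 3) (\<lambda>s. saturated 0 (matrix s))"
proof -
  have N1: "1 \<le> N" using N out_less by linarith
  define I where "I x s \<longleftrightarrow> sound_basis (matrix s) \<and>
      (\<forall>y<x. tree_vec (Leaf y) \<in> fn.span (range (matrix s)))"
    for x and s :: "'a store"
  let ?c = "Seq (sweeps leaf_step) insert_w"
  have "runs insert_leaves s0 ((234 + 18) * N ^ Suc 2) (I n)"
    unfolding insert_leaves_def
  proof (rule runs_for_loop)
    fix x s
    assume f: "frame (for_loop ''x'' (NVar ''n'') ?c) s0 s"
      and I: "I x s" and x: "nvar s ''x'' = x"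
    have r: "ready s" by (rule ready_frame[OF f s0]) auto
    let ?B = "insert_vec S (matrix s) (tree_vec (Leaf x))"
    have "runs ?c s (234 * N\<^sup>2) (\<lambda>s'. matrix s' = ?B)"
    proof (rule runs_Seq[OF runs_leaf[OF r x N(1)]])
      fix s1
      assume f1: "frame (sweeps leaf_step) s s1" and s1: "vec ''w'' s1 = tree_vec (Leaf x)"
      have r1: "ready s1" by (rule ready_frame[OF f1 r]) auto
      have "matrix s1 = matrix s" by (rule matrix_frame[OF f1]) simp
      then show "runs insert_w s1 (138 * N\<^sup>2) (\<lambda>s'. matrix s' = ?B)"
        using runs_insert_w[OF r1 N(1)] s1 by simp
    qed simp
    then show "runs ?c s (234 * N ^ 2) (I (Suc x))"
    proof (rule runs_weaken)
      fix s' assume s': "matrix s' = ?B"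
      have zero: "tree_vec (Leaf x) i = 0" if "S \<le> i" for i
        using that by (simp add: coef_def)
      have B: "sound_basis (matrix s)" "echelon S (matrix s)"
        using I by (auto simp: I_def sound_basis_def)
      have "sound_basis ?B"
        by (rule sound_basis_insert[OF B(1) _ zero])
          (auto simp: coef_space_def intro: fn.span_base)
      moreover have "fn.span (range (matrix s)) \<subseteq> fn.span (range ?B)"
        by (rule extends_span[OF B(2) insert_vec_extends[OF B(2) zero]])
      moreover have "tree_vec (Leaf x) \<in> fn.span (range ?B)"
        by (rule insert_vec_span[OF B(2) zero])
      ultimately show "I (Suc x) s'"
        using I by (auto simp: I_def s' less_Suc_eq)
    qed simp
  next
    show "I 0 s0"
      using fn_span_zero by (auto simp: I_def B sound_basis_def echelon_def coef_space_def)
  next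
    fix s
    assume f: "frame (for_loop ''x'' (NVar ''n'') ?c) s0 s"
    have "ready s" by (rule ready_frame[OF f s0]) auto
    then show "nval (NVar ''n'') s = n" by (simp add: ready_def input_intact_def)
  qed (use N N1 in \<open>auto simp: I_def\<close>)
  \<comment> \<open>For \<open>r = 0\<close> the bound on the pivots holds trivially, so the leaf
    vectors alone give \<open>saturated 0\<close>.\<close>
  then show ?thesis
    by (rule runs_weaken) (auto simp: I_def saturated_def numeral_3_eq_3)
qed

text \<open>One pair costs \<open>136 + 138 = 274\<close> times the square of \<open>N\<close>. The
  three loops add 18 each and raise the exponent from 2 to 5.\<close>

lemma runs_saturate:
  assumes s0: "ready s0" and sat: "saturated 0 (matrix s0)" and N: "Suc S \<le> N"
  shows "runs saturate s0 (328 * N ^ 5) (\<lambda>s. saturated (Suc S) (matrix s))"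
proof -
  have N': "S \<le> N" "1 \<le> N" using N by linarith+
  let ?c = "Seq (sweeps pair_step) insert_w"
  let ?q = "for_loop ''q'' (NVar ''size'') ?c"
  let ?p = "for_loop ''p'' (NVar ''size'') ?q"
  have "runs saturate s0 ((310 + 18) * N ^ Suc 4) (\<lambda>s. saturated (Suc S) (matrix s))"
    unfolding saturate_def
  proof (rule runs_for_loop[where I = "\<lambda>r s. saturated r (matrix s)"])
    fix k s1
    assume f1: "frame (for_loop ''r'' (NAdd (NVar ''size'') (NLit 1)) ?p) s0 s1"
      and sat1: "saturated k (matrix s1)"
    have r1: "ready s1" by (rule ready_frame[OF f1 s0]) auto
    let ?R = "\<lambda>Z s. round_invariant (matrix s1) (matrix s) Z"
    have "runs ?p s1 ((292 + 18) * N ^ Suc 3) (?R ({..<S} \<times> {..<S}))"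
    proof (rule runs_for_loop[where I = "\<lambda>p. ?R ({..<p} \<times> {..<S})"])
      fix p s2
      assume f2: "frame ?p s1 s2" and R2: "?R ({..<p} \<times> {..<S}) s2"
        and p: "nvar s2 ''p'' = p" "p < S"
      have r2: "ready s2" by (rule ready_frame[OF f2 r1]) auto
      \<comment> \<open>The processed pairs are the complete rows before \<open>p\<close> and an
        initial segment of row \<open>p\<close>.\<close>
      have "runs ?q s2 ((274 + 18) * N ^ Suc 2) (?R ({..<p} \<times> {..<S} \<union> {p} \<times> {..<S}))"
      proof (rule runs_for_loop[where I = "\<lambda>q. ?R ({..<p} \<times> {..<S} \<union> {p} \<times> {..<q})"])
        fix q s3
        assume f3: "frame ?q s2 s3" and R3: "?R ({..<p} \<times> {..<S} \<union> {p} \<times> {..<q}) s3"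
          and q: "nvar s3 ''q'' = q" "q < S"
        have r3: "ready s3" by (rule ready_frame[OF f3 r2]) auto
        have p3: "nvar s3 ''p'' = p" using f3 p by (simp add: frame_def)
        let ?B = "insert_vec S (matrix s3) (pair_vec (matrix s3) p q)"
        have "runs ?c s3 (274 * N\<^sup>2) (\<lambda>s'. matrix s' = ?B)"
        proof (rule runs_Seq[OF runs_pair[OF r3 p3 q(1) p(2) q(2) N'(1)]])
          fix s4
          assume f4: "frame (sweeps pair_step) s3 s4"
            and s4: "vec ''w'' s4 = pair_vec (matrix s3) p q"
          have r4: "ready s4" by (rule ready_frame[OF f4 r3]) auto
          have "matrix s4 = matrix s3" by (rule matrix_frame[OF f4]) simp
          then show "runs insert_w s4 (138 * N\<^sup>2) (\<lambda>s'. matrix s' = ?B)"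
            using runs_insert_w[OF r4 N'(1)] s4 by simp
        qed simp
        then show "runs ?c s3 (274 * N ^ 2) (?R ({..<p} \<times> {..<S} \<union> {p} \<times> {..<Suc q}))"
        proof (rule runs_weaken)
          have "{..<p} \<times> {..<S} \<union> {p} \<times> {..<Suc q} =
              insert (p, q) ({..<p} \<times> {..<S} \<union> {p} \<times> {..<q})"
            by auto
          then show "?R ({..<p} \<times> {..<S} \<union> {p} \<times> {..<Suc q}) s'" if "matrix s' = ?B" for s'
            using round_invariant_insert[OF R3, of p q] that by simp
        qed simp
      next
        fix s assume f: "frame ?q s2 s"
        show "nval (NVar ''size'') s = S"
          by (rule nval_size, rule ready_frame[OF f r2]) auto
      qed (use R2 N' in auto)
      moreover have "{..<p} \<times> {..<S} \<union> {p} \<times> {..<S} = {..<Suc p} \<times> {..<S}" by auto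
      ultimately show "runs ?q s2 (292 * N ^ 3) (?R ({..<Suc p} \<times> {..<S}))"
        by (simp add: numeral_3_eq_3 numeral_2_eq_2)
    next
      fix s assume f: "frame ?p s1 s"
      show "nval (NVar ''size'') s = S"
        by (rule nval_size, rule ready_frame[OF f r1]) auto
    next
      show "?R ({..<0} \<times> {..<S}) s1"
        using sat1 round_invariant_start by (simp add: saturated_def)
    qed (use N' in auto)
    then show "runs ?p s1 (310 * N ^ 4) (\<lambda>s. saturated (Suc k) (matrix s))"
      by (rule runs_weaken) (auto intro: saturated_round[OF sat1] simp: eval_nat_numeral)
  next
    fix s
    assume f: "frame (for_loop ''r'' (NAdd (NVar ''size'') (NLit 1)) ?p) s0 s"
    have "ready s" by (rule ready_frame[OF f s0]) auto
    then show "nval (NAdd (NVar ''size'') (NLit 1)) s = Suc S"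
      by (simp add: ready_def input_intact_def)
  qed (use sat N in auto)
  then show ?thesis by (rule runs_weaken) (auto simp: eval_nat_numeral)
qed

lemma runs_check_output:
  assumes s0: "ready s0" and N: "S \<le> N"
  shows "runs check_output s0 (58 * N) (\<lambda>s. nvar s ''result'' =
    (if const_coef (out \<Psi>) = 0 \<and> (\<forall>p<S. matrix s0 p (out \<Psi>) = 0) then 1 else 0))"
proof -
  have N1: "1 \<le> N" using N out_less by linarith
  let ?I = "\<lambda>m s. nvar s ''result'' =
    (if const_coef (out \<Psi>) = 0 \<and> (\<forall>p<m. matrix s0 p (out \<Psi>) = 0) then 1 else 0)"
  let ?b = "Cond (FIsZero (FArr ''c'' (NVar ''out'')))
      (NAssign ''result'' (NLit 1)) (NAssign ''result'' (NLit 0))"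
  let ?c = "Cond (FIsZero (entry ''p'' (NVar ''out''))) Skip (NAssign ''result'' (NLit 0))"
  let ?p = "for_loop ''p'' (NVar ''size'') ?c"
  have "runs check_output s0 (58 * N) (?I S)"
    unfolding check_output_def
  proof (rule runs_Seq)
    show "runs ?b s0 20 (?I 0)"
      using s0 out_less
      by (intro runs_Cond runs_NAssign) (auto simp: ready_def input_intact_def consts_ready_def)
  next
    fix s1
    assume f1: "frame ?b s0 s1" and I1: "?I 0 s1"
    have r1: "ready s1" by (rule ready_frame[OF f1 s0]) auto
    have B1: "matrix s1 = matrix s0" by (rule matrix_frame[OF f1]) simp
    have "runs ?p s1 ((20 + 18) * N ^ Suc 0) (?I S)"
    proof (rule runs_for_loop[where I = ?I])
      fix k s
      assume f: "frame ?p s1 s" and I: "?I k s" and k: "nvar s ''p'' = k" "k < S"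
      have r: "ready s" by (rule ready_frame[OF f r1]) auto
      have B: "matrix s = matrix s0" using matrix_frame[OF f] B1 by simp
      have "fval (entry ''p'' (NVar ''out'')) s = matrix s0 k (out \<Psi>)"
        using fval_entry[OF r k, of "NVar ''out''"] r out_less
        by (simp add: B ready_def input_intact_def)
      then show "runs ?c s (20 * N ^ 0) (?I (Suc k))"
        using I by (intro runs_Cond runs_Skip runs_NAssign) (auto simp: less_Suc_eq simp del: fval.simps)
    next
      fix s assume f: "frame ?p s1 s"
      show "nval (NVar ''size'') s = S"
        by (rule nval_size, rule ready_frame[OF f r1]) auto
    qed (use I1 N N1 in auto)
    then show "runs ?p s1 (38 * N) (?I S)" by simp
  qed (use N1 in simp)
  then show ?thesis .
qed

lemma runs_compute_rows:
  assumes s0: "input_intact s0" "narr s0 ''row'' 0 = 0" and N: "S \<le> N"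
  shows "runs compute_rows s0 (38 * N) rows_ready"
proof -
  let ?I = "\<lambda>m s. \<forall>p\<le>m. narr s ''row'' p = p * S"
  have "runs compute_rows s0 ((20 + 18) * N ^ Suc 0) (?I S)"
    unfolding compute_rows_def
  proof (rule runs_for_loop[where I = ?I])
    fix k s
    let ?c = "NStore ''row'' (NAdd (NVar ''p'') (NLit 1)) (NAdd (NArr ''row'' (NVar ''p'')) (NVar ''size''))"
    assume f: "frame (for_loop ''p'' (NVar ''size'') ?c) s0 s" and I: "?I k s" "nvar s ''p'' = k"
    have "nvar s ''size'' = S" using f s0(1) by (simp add: frame_def input_intact_def)
    then show "runs ?c s (20 * N ^ 0) (?I (Suc k))"
      using I by (intro runs_NStore) (auto simp: le_Suc_eq)
  qed (use s0 N out_less in \<open>auto simp: frame_def input_intact_def\<close>)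
  then show ?thesis
    by (rule runs_weaken) (auto simp: rows_ready_def)
qed

text \<open>The constant is the sum over the five phases, \<open>38 + 76 + 252 + 328 + 58\<close>,
  with all smaller powers of \<open>N\<close> raised to the fifth.\<close>

lemma runs_identity_test:
  assumes s0: "input_intact s0" "narr s0 ''row'' 0 = 0" "farr s0 ''B'' = (\<lambda>_. 0)"
    and N: "Suc S \<le> N" "n \<le> N" and f: "circuit_computes \<Psi> f"
  shows "runs identity_test s0 (752 * N ^ 5) (\<lambda>s. nvar s ''result'' = (if f = 0 then 1 else 0))"
proof -
  have N': "S \<le> N" "1 \<le> N" using N by linarith+
  have pow: "N \<le> N ^ 5" "N\<^sup>2 \<le> N ^ 5" "N ^ 3 \<le> N ^ 5"
    using power_increasing[of 1 5 N] power_increasing[of 2 5 N] power_increasing[of 3 5 N] N'(2)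
    by simp_all
  show ?thesis
    unfolding identity_test_def
  proof (rule runs_Seq[OF runs_compute_rows[OF s0(1,2) N'(1)]])
    fix s1
    assume f1: "frame compute_rows s0 s1" and rows1: "rows_ready s1"
    have in1: "input_intact s1" by (rule input_intact_frame[OF f1 s0(1)]) auto
    show "runs (Seq (sweeps const_step) (Seq insert_leaves (Seq saturate check_output))) s1
      (714 * N ^ 5) (\<lambda>s. nvar s ''result'' = (if f = 0 then 1 else 0))"
    proof (rule runs_Seq[OF runs_consts[OF in1 N'(1)]])
      fix s2
      assume f2: "frame (sweeps const_step) s1 s2" and c2: "consts_ready s2"
      have "input_intact s2" by (rule input_intact_frame[OF f2 in1]) auto
      moreover have "rows_ready s2" using f2 rows1 by (simp add: rows_ready_def frame_def)
      ultimately have r2: "ready s2" using c2 by (simp add: ready_def)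
      have B2: "matrix s2 = (\<lambda>_ _. 0)"
        using f1 f2 s0(3) by (simp add: frame_def matrix_def fun_eq_iff)
      show "runs (Seq insert_leaves (Seq saturate check_output)) s2
        (638 * N ^ 5) (\<lambda>s. nvar s ''result'' = (if f = 0 then 1 else 0))"
      proof (rule runs_Seq[OF runs_insert_leaves[OF r2 B2 N'(1) N(2)]])
        fix s3
        assume f3: "frame insert_leaves s2 s3" and sat3: "saturated 0 (matrix s3)"
        have r3: "ready s3" by (rule ready_frame[OF f3 r2]) auto
        show "runs (Seq saturate check_output) s3
          (386 * N ^ 5) (\<lambda>s. nvar s ''result'' = (if f = 0 then 1 else 0))"
        proof (rule runs_Seq[OF runs_saturate[OF r3 sat3 N(1)]])
          fix s4
          assume f4: "frame saturate s3 s4" and sat4: "saturated (Suc S) (matrix s4)"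
          have r4: "ready s4" by (rule ready_frame[OF f4 r3]) auto
          show "runs check_output s4 (58 * N) (\<lambda>s. nvar s ''result'' = (if f = 0 then 1 else 0))"
            using runs_check_output[OF r4 N'(1)] zero_iff[OF sat4 f] by simp
        qed (use pow in linarith)
      qed (use pow in linarith)
    qed (use pow in linarith)
  qed (use pow in linarith)
qed

end

theorem mainTheorem3:
  shows "\<exists>(P :: com) (c :: nat) (k :: nat).
    \<forall>(n :: nat) (d :: nat) (\<Psi> :: 'a::field circuit) (f :: 'a napoly).
      circuit_over n \<Psi> \<and> circuit_computes \<Psi> f \<and> np_degree f \<le> d \<longrightarrow>
      (\<exists>t s'. exec P (input_store n d \<Psi>) t s' \<and>
              t \<le> c * (circuit_size \<Psi> + n + d) ^ k \<and>
              nvar s' ''result'' = (if f = 0 then 1 else 0))"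
proof (rule exI[of _ identity_test], rule exI[of _ "752 * 2 ^ 5"], rule exI[of _ 5],
    intro allI impI)
  fix n d and \<Psi> :: "'a circuit" and f :: "'a napoly"
  assume H: "circuit_over n \<Psi> \<and> circuit_computes \<Psi> f \<and> np_degree f \<le> d"
  interpret valid_circuit n \<Psi>
    using H by unfold_locales simp
  let ?M = "circuit_size \<Psi> + n + d"
  \<comment> \<open>The output gate exists, so the size is at least 1 and \<open>2 * ?M\<close> is
    at least \<open>Suc S\<close>. This doubling is the source of the factor
    \<open>2 ^ 5\<close>.\<close>
  have "runs identity_test (input_store n d \<Psi>) (752 * (2 * ?M) ^ 5)
      (\<lambda>s. nvar s ''result'' = (if f = 0 then 1 else 0))"
    by (rule runs_identity_test)
      (use H out_less in \<open>auto simp: input_store_def input_intact_def\<close>)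
  then show "\<exists>t s'. exec identity_test (input_store n d \<Psi>) t s' \<and> t \<le> (752 * 2 ^ 5) * ?M ^ 5 \<and>
      nvar s' ''result'' = (if f = 0 then 1 else 0)"
    unfolding runs_def by (simp only: power_mult_distrib mult.assoc)
qed

end
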